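(* Let $\nu$ be an odd natural number and let $k$ be a field containing a primitive $2\nu$-th root of unity $\omega$ and in which $2\nu$ is invertible. Let $H_\nu$ be Radford's $4\nu$-dimensional Hopf algebra over $k$. Then any quasitriangular structure $R_{s,\beta}$ on $H_\nu$ (where $\beta\in k$ and $s$ is an odd integer with $1\le s<2\nu$) is pseudotriangular.
   Context: $H_\nu$ is the Hopf algebra over $k$ generated as an algebra by two elements $g$ and $x$ with relations $g^{2\nu}=1$, $gx+xg=0$, $x^2=0$, with coproduct $\Delta(g)=g\otimes g$, $\Delta(x)=x\otimes g^{\nu}+1\otimes x$ (hence counit $\varepsilon(g)=1$, $\varepsilon(x)=0$) and antipode $S(g)=g^{-1}$, $S(x)=g^{\nu}x$. A linear basis is $\{g^lx^m : 0\le l<2\nu,\ 0\le m\le 1\}$. The quasitriangular structures of $H_\nu$ are (by a result of Radford) parametrized by pairs $(s,\beta)$ with $\beta\in k$ and $s$ an odd integer with $1\le s<2\nu$; the one corresponding to $(s,\beta)$ is $$R_{s,\beta}=\frac{1}{2\nu}\Big(\sum_{i,l=0}^{2\nu-1}\omega^{-il}g^i\otimes g^{sl}\Big)+\frac{\beta}{2\nu}\Big(\sum_{i,l=0}^{2\nu-1}\omega^{-il}g^ix\otimes g^{sl+\nu}x\Big).$$ A quasitriangular structure $R\in H\otimes H$ on a Hopf algebra $H$ is called pseudotriangular if $R_{12}R^{-1}_{31}R_{23}=R_{23}R^{-1}_{31}R_{12}$ in $H\otimes H\otimes H$, where for $Q=\sum a\otimes b\in H\otimes H$ one writes $Q_{12}=\sum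 a\otimes b\otimes 1$, $Q_{23}=\sum 1\otimes a\otimes b$, $Q_{31}=\sum b\otimes 1\otimes a$, and $R^{-1}_{31}=(R^{-1})_{31}$. *)

theory Defs
  imports Complex_Main
begin

section \<open>Finite-dimensional algebras and Hopf algebras in coordinates\<close>

text \<open>
  A finite-dimensional vector space is given by a finite basis \<open>B\<close>; its elements are the coordinate
  functions \<open>'b \<Rightarrow> 'k\<close> vanishing off \<open>B\<close>. The tensor product of the spaces with bases \<open>B\<close> and \<open>C\<close>
  is the space with basis \<open>B \<times> C\<close>.
  \<open>mult_coeff A a b c\<close> is the coefficient of the basis vector \<open>c\<close> in the product of the
  basis vectors \<open>a\<close> and \<open>b\<close>.
\<close>

record ('k, 'b) based_alg =
  basis :: "'b set"
  mult_coeff :: "'b \<Rightarrow> 'b \<Rightarrow> 'b \<Rightarrow> 'k"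
  unit :: "'b \<Rightarrow> 'k"

definition elems :: "('k::field, 'b, 'm) based_alg_scheme \<Rightarrow> ('b \<Rightarrow> 'k) set" where
  "elems A = {u. \<forall>b. b \<notin> basis A \<longrightarrow> u b = 0}"

definition bvec :: "'b \<Rightarrow> 'b \<Rightarrow> 'k::field" where
  "bvec b = (\<lambda>c. if c = b then 1 else 0)"

definition amult :: "('k::field, 'b, 'm) based_alg_scheme \<Rightarrow> ('b \<Rightarrow> 'k) \<Rightarrow> ('b \<Rightarrow> 'k) \<Rightarrow> 'b \<Rightarrow> 'k" where
  "amult A u v = (\<lambda>c. if c \<in> basis A
     then \<Sum>a\<in>basis A. \<Sum>b\<in>basis A. u a * v b * mult_coeff A a b c else 0)"

primrec apow :: "('k::field, 'b, 'm) based_alg_scheme \<Rightarrow> ('b \<Rightarrow> 'k) \<Rightarrow> nat \<Rightarrow> 'b \<Rightarrow> 'k" where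
  "apow A u 0 = unit A"
| "apow A u (Suc n) = amult A u (apow A u n)"

definition assoc_algebra :: "('k::field, 'b, 'm) based_alg_scheme \<Rightarrow> bool" where
  "assoc_algebra A \<longleftrightarrow> finite (basis A) \<and> unit A \<in> elems A \<and>
     (\<forall>u\<in>elems A. \<forall>v\<in>elems A. \<forall>w\<in>elems A. amult A (amult A u v) w = amult A u (amult A v w)) \<and>
     (\<forall>u\<in>elems A. amult A (unit A) u = u \<and> amult A u (unit A) = u)"

definition tensor_vec :: "('b \<Rightarrow> 'k::field) \<Rightarrow> ('c \<Rightarrow> 'k) \<Rightarrow> 'b \<times> 'c \<Rightarrow> 'k"  (infixr "\<otimes>\<^sub>v" 70) where
  "u \<otimes>\<^sub>v v = (\<lambda>(b, c). u b * v c)"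

definition tensor_alg ::
  "('k::field, 'b, 'm) based_alg_scheme \<Rightarrow> ('k, 'c, 'n) based_alg_scheme \<Rightarrow> ('k, 'b \<times> 'c) based_alg"
  (infixr "\<otimes>\<^sub>a" 70) where
  "A \<otimes>\<^sub>a B = \<lparr> basis = basis A \<times> basis B,
     mult_coeff = (\<lambda>(a, a') (b, b') (c, c'). mult_coeff A a b c * mult_coeff B a' b' c'),
     unit = unit A \<otimes>\<^sub>v unit B \<rparr>"

text \<open>
  The fields \<open>comult_bas\<close>, \<open>counit_bas\<close> and \<open>antipode_bas\<close> hold the values of the structure maps
  on basis vectors.
\<close>

record ('k, 'b) based_hopf = "('k, 'b) based_alg" +
  comult_bas :: "'b \<Rightarrow> 'b \<times> 'b \<Rightarrow> 'k"
  counit_bas :: "'b \<Rightarrow> 'k"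
  antipode_bas :: "'b \<Rightarrow> 'b \<Rightarrow> 'k"

definition comult :: "('k::field, 'b, 'm) based_hopf_scheme \<Rightarrow> ('b \<Rightarrow> 'k) \<Rightarrow> 'b \<times> 'b \<Rightarrow> 'k" where
  "comult H u = (\<lambda>p. \<Sum>b\<in>basis H. u b * comult_bas H b p)"

definition counit :: "('k::field, 'b, 'm) based_hopf_scheme \<Rightarrow> ('b \<Rightarrow> 'k) \<Rightarrow> 'k" where
  "counit H u = (\<Sum>b\<in>basis H. u b * counit_bas H b)"

definition antipode :: "('k::field, 'b, 'm) based_hopf_scheme \<Rightarrow> ('b \<Rightarrow> 'k) \<Rightarrow> 'b \<Rightarrow> 'k" where
  "antipode H u = (\<lambda>c. \<Sum>b\<in>basis H. u b * antipode_bas H b c)"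

text \<open>\<open>\<Delta> \<otimes> id\<close> and \<open>id \<otimes> \<Delta>\<close>, as maps from \<open>H \<otimes> H\<close> to \<open>H \<otimes> H \<otimes> H\<close>:\<close>

definition comult_fst ::
  "('k::field, 'b, 'm) based_hopf_scheme \<Rightarrow> ('b \<times> 'b \<Rightarrow> 'k) \<Rightarrow> 'b \<times> 'b \<times> 'b \<Rightarrow> 'k" where
  "comult_fst H Q = (\<lambda>(a, b, c). \<Sum>d\<in>basis H. Q (d, c) * comult_bas H d (a, b))"

definition comult_snd ::
  "('k::field, 'b, 'm) based_hopf_scheme \<Rightarrow> ('b \<times> 'b \<Rightarrow> 'k) \<Rightarrow> 'b \<times> 'b \<times> 'b \<Rightarrow> 'k" where
  "comult_snd H Q = (\<lambda>(a, b, c). \<Sum>d\<in>basis H. Q (a, d) * comult_bas H d (b, c))"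

text \<open>
  In the last two lines \<open>\<Sum>p. \<Delta>(h)(p) \<cdot> S(p\<^sub>1) p\<^sub>2\<close> is \<open>m (S \<otimes> id) \<Delta>(h)\<close>,
  written out in the basis \<open>p = (p\<^sub>1, p\<^sub>2)\<close> of \<open>H \<otimes> H\<close>.
\<close>

definition hopf_algebra :: "('k::field, 'b, 'm) based_hopf_scheme \<Rightarrow> bool" where
  "hopf_algebra H \<longleftrightarrow> assoc_algebra H \<and>
     (\<forall>u\<in>elems H. comult H u \<in> elems (H \<otimes>\<^sub>a H) \<and> antipode H u \<in> elems H) \<and>
     comult H (unit H) = unit (H \<otimes>\<^sub>a H) \<and>
     (\<forall>u\<in>elems H. \<forall>v\<in>elems H. comult H (amult H u v) = amult (H \<otimes>\<^sub>a H) (comult H u) (comult H v)) \<and>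
     counit H (unit H) = 1 \<and>
     (\<forall>u\<in>elems H. \<forall>v\<in>elems H. counit H (amult H u v) = counit H u * counit H v) \<and>
     (\<forall>u\<in>elems H. comult_fst H (comult H u) = comult_snd H (comult H u)) \<and>
     (\<forall>u\<in>elems H. (\<lambda>b. \<Sum>a\<in>basis H. comult H u (a, b) * counit_bas H a) = u) \<and>
     (\<forall>u\<in>elems H. (\<lambda>a. \<Sum>b\<in>basis H. comult H u (a, b) * counit_bas H b) = u) \<and>
     (\<forall>u\<in>elems H. (\<lambda>c. \<Sum>(a, b)\<in>basis H \<times> basis H.
          comult H u (a, b) * amult H (antipode H (bvec a)) (bvec b) c) = (\<lambda>c. counit H u * unit H c)) \<and>
     (\<forall>u\<in>elems H. (\<lambda>c. \<Sum>(a, b)\<in>basis H \<times> basis H.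
          comult H u (a, b) * amult H (bvec a) (antipode H (bvec b)) c) = (\<lambda>c. counit H u * unit H c))"

section \<open>Quasitriangular and pseudotriangular structures\<close>

definition place12 :: "('k::field, 'b, 'm) based_alg_scheme \<Rightarrow> ('b \<times> 'b \<Rightarrow> 'k) \<Rightarrow> 'b \<times> 'b \<times> 'b \<Rightarrow> 'k" where
  "place12 A Q = (\<lambda>(a, b, c). Q (a, b) * unit A c)"

definition place13 :: "('k::field, 'b, 'm) based_alg_scheme \<Rightarrow> ('b \<times> 'b \<Rightarrow> 'k) \<Rightarrow> 'b \<times> 'b \<times> 'b \<Rightarrow> 'k" where
  "place13 A Q = (\<lambda>(a, b, c). Q (a, c) * unit A b)"

definition place23 :: "('k::field, 'b, 'm) based_alg_scheme \<Rightarrow> ('b \<times> 'b \<Rightarrow> 'k) \<Rightarrow> 'b \<times> 'b \<times> 'b \<Rightarrow> 'k" where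
  "place23 A Q = (\<lambda>(a, b, c). unit A a * Q (b, c))"

text \<open>The first tensor factor of \<open>Q\<close> goes to slot 3 and the second one to slot 1.\<close>

definition place31 :: "('k::field, 'b, 'm) based_alg_scheme \<Rightarrow> ('b \<times> 'b \<Rightarrow> 'k) \<Rightarrow> 'b \<times> 'b \<times> 'b \<Rightarrow> 'k" where
  "place31 A Q = (\<lambda>(a, b, c). Q (c, a) * unit A b)"

definition is_inverse ::
  "('k::field, 'b, 'm) based_alg_scheme \<Rightarrow> ('b \<Rightarrow> 'k) \<Rightarrow> ('b \<Rightarrow> 'k) \<Rightarrow> bool" where
  "is_inverse A u v \<longleftrightarrow> u \<in> elems A \<and> v \<in> elems A \<and> amult A u v = unit A \<and> amult A v u = unit A"

text \<open>
  Drinfeld's axioms: \<open>R\<close> is invertible, \<open>(\<Delta> \<otimes> id) R = R\<^sub>1\<^sub>3 R\<^sub>2\<^sub>3\<close>, \<open>(id \<otimes> \<Delta>) R = R\<^sub>1\<^sub>3 R\<^sub>1\<^sub>2\<close> and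
  \<open>\<Delta>\<^sup>o\<^sup>p(h) R = R \<Delta>(h)\<close> for all \<open>h\<close>.
\<close>

definition quasitriangular :: "('k::field, 'b, 'm) based_hopf_scheme \<Rightarrow> ('b \<times> 'b \<Rightarrow> 'k) \<Rightarrow> bool" where
  "quasitriangular H R \<longleftrightarrow> hopf_algebra H \<and> (\<exists>R'. is_inverse (H \<otimes>\<^sub>a H) R R') \<and>
     comult_fst H R = amult (H \<otimes>\<^sub>a H \<otimes>\<^sub>a H) (place13 H R) (place23 H R) \<and>
     comult_snd H R = amult (H \<otimes>\<^sub>a H \<otimes>\<^sub>a H) (place13 H R) (place12 H R) \<and>
     (\<forall>h\<in>elems H. amult (H \<otimes>\<^sub>a H) (\<lambda>(a, b). comult H h (b, a)) R = amult (H \<otimes>\<^sub>a H) R (comult H h))"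

definition pseudotriangular :: "('k::field, 'b, 'm) based_hopf_scheme \<Rightarrow> ('b \<times> 'b \<Rightarrow> 'k) \<Rightarrow> bool" where
  "pseudotriangular H R \<longleftrightarrow> quasitriangular H R \<and>
     (let A = H \<otimes>\<^sub>a H \<otimes>\<^sub>a H; R' = (THE R'. is_inverse (H \<otimes>\<^sub>a H) R R') in
        amult A (amult A (place12 H R) (place31 H R')) (place23 H R) =
        amult A (amult A (place23 H R) (place31 H R')) (place12 H R))"

section \<open>Radford's Hopf algebra\<close>

text \<open>
  The pair \<open>(l, m)\<close> stands for the basis vector \<open>g\<^sup>l x\<^sup>m\<close>; moving \<open>x\<^sup>m\<close> past \<open>g\<^sup>p\<close> gives
  the sign in \<open>(g\<^sup>l x\<^sup>m) (g\<^sup>p x\<^sup>q) = (-1)\<^sup>m\<^sup>p g\<^sup>l\<^sup>+\<^sup>p x\<^sup>m\<^sup>+\<^sup>q\<close>, where \<open>x\<^sup>2 = 0\<close>. The lemmas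
  \<open>radford_relations\<close>, \<open>radford_universal\<close> and \<open>radford_universal_unique\<close> below show that this is the
  algebra presented by the generators \<open>g\<close>, \<open>x\<close> and the relations
  \<open>g\<^sup>2\<^sup>\<nu> = 1\<close>, \<open>g x + x g = 0\<close>, \<open>x\<^sup>2 = 0\<close>.
\<close>

definition radford_alg :: "nat \<Rightarrow> ('k::field, nat \<times> nat) based_alg" where
  "radford_alg \<nu> = \<lparr> basis = {..<2 * \<nu>} \<times> {..<2},
     mult_coeff = (\<lambda>(l, m) (p, q) (r, t).
       if r = (l + p) mod (2 * \<nu>) \<and> t = m + q then (- 1) ^ (m * p) else 0),
     unit = bvec (0, 0) \<rparr>"

definition rad_g :: "nat \<times> nat \<Rightarrow> 'k::field" where
  "rad_g = bvec (1, 0)"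

definition rad_x :: "nat \<times> nat \<Rightarrow> 'k::field" where
  "rad_x = bvec (0, 1)"

text \<open>
  \<open>\<Delta>\<close>, \<open>\<epsilon>\<close> are extended to the basis vectors \<open>g\<^sup>l x\<^sup>m\<close> multiplicatively from
  \<open>\<Delta>(g) = g \<otimes> g\<close>, \<open>\<Delta>(x) = x \<otimes> g\<^sup>\<nu> + 1 \<otimes> x\<close>, \<open>\<epsilon>(g) = 1\<close>, \<open>\<epsilon>(x) = 0\<close>, and \<open>S\<close> antimultiplicatively
  from \<open>S(g) = g\<^sup>-\<^sup>1 = g\<^sup>2\<^sup>\<nu>\<^sup>-\<^sup>1\<close>, \<open>S(x) = g\<^sup>\<nu> x\<close>.
\<close>

definition radford_hopf :: "nat \<Rightarrow> ('k::field, nat \<times> nat) based_hopf" where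
  "radford_hopf \<nu> = (let A = radford_alg \<nu>; T = A \<otimes>\<^sub>a A in
     \<lparr> basis = basis A, mult_coeff = mult_coeff A, unit = unit A,
       comult_bas = (\<lambda>(l, m). amult T (apow T (rad_g \<otimes>\<^sub>v rad_g) l)
          (apow T (\<lambda>p. (rad_x \<otimes>\<^sub>v apow A rad_g \<nu>) p + (unit A \<otimes>\<^sub>v rad_x) p) m)),
       counit_bas = (\<lambda>(l, m). 1 ^ l * 0 ^ m),
       antipode_bas = (\<lambda>(l, m). amult A (apow A (amult A (apow A rad_g \<nu>) rad_x) m)
          (apow A (apow A rad_g (2 * \<nu> - 1)) l)) \<rparr>)"

definition primitive_root_of_unity :: "nat \<Rightarrow> 'k::field \<Rightarrow> bool" where
  "primitive_root_of_unity n w \<longleftrightarrow> 0 < n \<and> w ^ n = 1 \<and> (\<forall>j. 0 < j \<and> j < n \<longrightarrow> w ^ j \<noteq> 1)"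

definition radford_R ::
  "nat \<Rightarrow> 'k::field \<Rightarrow> nat \<Rightarrow> 'k \<Rightarrow> (nat \<times> nat) \<times> (nat \<times> nat) \<Rightarrow> 'k" where
  "radford_R \<nu> w s \<beta> = (let H = radford_hopf \<nu>; g = rad_g; x = rad_x in
     (\<lambda>p. 1 / of_nat (2 * \<nu>) *
            (\<Sum>i\<in>{0..2*\<nu>-1}. \<Sum>l\<in>{0..2*\<nu>-1}. inverse w ^ (i * l) *
               (apow H g i \<otimes>\<^sub>v apow H g (s * l)) p)
        + \<beta> / of_nat (2 * \<nu>) *
            (\<Sum>i\<in>{0..2*\<nu>-1}. \<Sum>l\<in>{0..2*\<nu>-1}. inverse w ^ (i * l) *
               (amult H (apow H g i) x \<otimes>\<^sub>v amult H (apow H g (s * l + \<nu>)) x) p)))"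

section \<open>Radford's algebra is the presented Hopf algebra\<close>

subsection \<open>Linear extension\<close>

lemma bvec_expand:
  assumes "finite B" "\<And>b. b \<notin> B \<Longrightarrow> u b = 0"
  shows "u = (\<lambda>c. \<Sum>b\<in>B. u b * bvec b c)"
  using assms by (auto simp: bvec_def fun_eq_iff if_distrib[of "\<lambda>t. _ * t"] cong: if_cong)

lemma linear_ext:
  fixes F G :: "('b \<Rightarrow> 'k::field) \<Rightarrow> 'c \<Rightarrow> 'k"
  assumes fin: "finite B" and u: "\<And>b. b \<notin> B \<Longrightarrow> u b = 0"
    and F: "\<And>u v. F (\<lambda>x. u x + v x) = (\<lambda>p. F u p + F v p)" "\<And>c u. F (\<lambda>x. c * u x) = (\<lambda>p. c * F u p)"
    and G: "\<And>u v. G (\<lambda>x. u x + v x) = (\<lambda>p. G u p + G v p)" "\<And>c u. G (\<lambda>x. c * u x) = (\<lambda>p. c * G u p)"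
    and eq: "\<And>b. b \<in> B \<Longrightarrow> F (bvec b) = G (bvec b)"
  shows "F u = G u"
proof -
  have "F (\<lambda>c. \<Sum>b\<in>B'. u b * bvec b c) = G (\<lambda>c. \<Sum>b\<in>B'. u b * bvec b c)" if "B' \<subseteq> B" for B'
    using finite_subset[OF that fin] that
  proof (induction B' rule: finite_induct)
    case empty
    show ?case using F(2)[of 0 "\<lambda>_. 0"] G(2)[of 0 "\<lambda>_. 0"] by simp
  next
    case (insert b B')
    then show ?case by (simp add: F G eq)
  qed
  from this[of B] show ?thesis using bvec_expand[of B u, OF fin u] by simp
qed

lemma amult_linear:
  "amult A (\<lambda>x. u x + u' x) v = (\<lambda>p. amult A u v p + amult A u' v p)"
  "amult A v (\<lambda>x. u x + u' x) = (\<lambda>p. amult A v u p + amult A v u' p)"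
  "amult A (\<lambda>x. c * u x) v = (\<lambda>p. c * amult A u v p)"
  "amult A v (\<lambda>x. c * u x) = (\<lambda>p. c * amult A v u p)"
  "amult A (\<lambda>x. 0) v = (\<lambda>p. 0)"
  "amult A v (\<lambda>x. 0) = (\<lambda>p. 0)"
  by (auto simp: amult_def fun_eq_iff algebra_simps sum.distrib sum_distrib_left)

lemma amult_elems: "amult A u v \<in> elems A"
  by (auto simp: amult_def elems_def)

lemma bvec_elems: "bvec b \<in> elems A \<longleftrightarrow> b \<in> basis A"
  by (auto simp: bvec_def elems_def)

lemma amult_bvec:
  assumes "finite (basis A)" "a \<in> basis A" "b \<in> basis A"
  shows "amult A (bvec a) (bvec b) = (\<lambda>c. if c \<in> basis A then mult_coeff A a b c else 0)"
proof -
  have "(\<Sum>i\<in>basis A. \<Sum>j\<in>basis A. bvec a i * bvec b j * mult_coeff A i j c) = mult_coeff A a b c" for c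
  proof -
    have "(\<Sum>j\<in>basis A. bvec a i * bvec b j * mult_coeff A i j c) = (if i = a then mult_coeff A a b c else 0)" for i
      using assms by (simp add: bvec_def if_distrib[of "\<lambda>t. t * _"] cong: if_cong)
    then show ?thesis using assms by simp
  qed
  then show ?thesis by (auto simp: amult_def fun_eq_iff)
qed

lemma bvec_tensor: "bvec (a, b) = bvec a \<otimes>\<^sub>v bvec b"
  by (auto simp: bvec_def tensor_vec_def)

lemma amult_tensor:
  "amult (A \<otimes>\<^sub>a B) (u \<otimes>\<^sub>v u') (v \<otimes>\<^sub>v v') = amult A u v \<otimes>\<^sub>v amult B u' v'"
proof -
  have "(\<Sum>p\<in>basis A \<times> basis B. \<Sum>q\<in>basis A \<times> basis B. (u \<otimes>\<^sub>v u') p * (v \<otimes>\<^sub>v v') q *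
          mult_coeff (A \<otimes>\<^sub>a B) p q (c, d)) =
        (\<Sum>a\<in>basis A. \<Sum>b\<in>basis A. u a * v b * mult_coeff A a b c) *
        (\<Sum>a\<in>basis B. \<Sum>b\<in>basis B. u' a * v' b * mult_coeff B a b d)" for c d
  proof -
    have "(\<Sum>p\<in>basis A \<times> basis B. \<Sum>q\<in>basis A \<times> basis B. (u \<otimes>\<^sub>v u') p * (v \<otimes>\<^sub>v v') q *
            mult_coeff (A \<otimes>\<^sub>a B) p q (c, d)) =
          (\<Sum>a\<in>basis A. \<Sum>a'\<in>basis B. \<Sum>b\<in>basis A. \<Sum>b'\<in>basis B.
            (u a * v b * mult_coeff A a b c) * (u' a' * v' b' * mult_coeff B a' b' d))"
      unfolding tensor_vec_def tensor_alg_def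
      by (simp add: sum.cartesian_product' mult_ac)
    also have "\<dots> = (\<Sum>a\<in>basis A. \<Sum>b\<in>basis A. \<Sum>a'\<in>basis B. \<Sum>b'\<in>basis B.
            (u a * v b * mult_coeff A a b c) * (u' a' * v' b' * mult_coeff B a' b' d))"
      by (intro sum.cong refl sum.swap)
    also have "\<dots> = (\<Sum>a\<in>basis A. \<Sum>b\<in>basis A. u a * v b * mult_coeff A a b c) *
        (\<Sum>a\<in>basis B. \<Sum>b\<in>basis B. u' a * v' b * mult_coeff B a b d)"
      by (simp only: sum_distrib_right, simp only: sum_distrib_left)
    finally show ?thesis .
  qed
  then show ?thesis
    by (auto simp: amult_def fun_eq_iff tensor_vec_def tensor_alg_def)
qed

lemma tensor_vec_linear:
  "(\<lambda>x. u x + u' x) \<otimes>\<^sub>v v = (\<lambda>p. (u \<otimes>\<^sub>v v) p + (u' \<otimes>\<^sub>v v) p)"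
  "v \<otimes>\<^sub>v (\<lambda>x. u x + u' x) = (\<lambda>p. (v \<otimes>\<^sub>v u) p + (v \<otimes>\<^sub>v u') p)"
  "(\<lambda>x. c * u x) \<otimes>\<^sub>v v = (\<lambda>p. c * (u \<otimes>\<^sub>v v) p)"
  "v \<otimes>\<^sub>v (\<lambda>x. c * u x) = (\<lambda>p. c * (v \<otimes>\<^sub>v u) p)"
  "(\<lambda>x. 0) \<otimes>\<^sub>v v = (\<lambda>p. 0)"
  "v \<otimes>\<^sub>v (\<lambda>x. 0) = (\<lambda>p. 0)"
  "(\<lambda>x. - u x) \<otimes>\<^sub>v v = (\<lambda>p. - (u \<otimes>\<^sub>v v) p)"
  "v \<otimes>\<^sub>v (\<lambda>x. - u x) = (\<lambda>p. - (v \<otimes>\<^sub>v u) p)"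
  by (auto simp: tensor_vec_def fun_eq_iff algebra_simps)

lemma comult_linear:
  "comult H (\<lambda>x. u x + u' x) = (\<lambda>p. comult H u p + comult H u' p)"
  "comult H (\<lambda>x. c * u x) = (\<lambda>p. c * comult H u p)"
  "comult H (\<lambda>x. 0) = (\<lambda>p. 0)"
  by (auto simp: comult_def fun_eq_iff algebra_simps sum.distrib sum_distrib_left)

lemma counit_linear:
  "counit H (\<lambda>x. u x + u' x) = counit H u + counit H u'"
  "counit H (\<lambda>x. c * u x) = c * counit H u"
  "counit H (\<lambda>x. 0) = 0"
  by (auto simp: counit_def algebra_simps sum.distrib sum_distrib_left)

lemma antipode_linear:
  "antipode H (\<lambda>x. u x + u' x) = (\<lambda>p. antipode H u p + antipode H u' p)"
  "antipode H (\<lambda>x. c * u x) = (\<lambda>p. c * antipode H u p)"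
  "antipode H (\<lambda>x. 0) = (\<lambda>p. 0)"
  by (auto simp: antipode_def fun_eq_iff algebra_simps sum.distrib sum_distrib_left)

lemma structure_bvec:
  assumes "finite (basis H)" "b \<in> basis H"
  shows "comult H (bvec b) = comult_bas H b" "counit H (bvec b) = counit_bas H b"
    "antipode H (bvec b) = antipode_bas H b"
  using assms by (auto simp: comult_def counit_def antipode_def bvec_def fun_eq_iff
      if_distrib[of "\<lambda>t. t * _"] cong: if_cong)

subsection \<open>Products of basis vectors\<close>

lemma radford_basis: "basis (radford_alg \<nu>) = {..<2 * \<nu>} \<times> {..<2}"
  by (simp add: radford_alg_def)

lemma radford_unit: "unit (radford_alg \<nu>) = bvec (0, 0)"
  by (simp add: radford_alg_def)

lemma radford_mult:
  assumes "l < 2 * \<nu>" "p < 2 * \<nu>" "m < 2" "q < 2"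
  shows "amult (radford_alg \<nu> :: ('k::field, _) based_alg) (bvec (l, m)) (bvec (p, q)) =
    (if m + q < 2 then (\<lambda>c. (- 1) ^ (m * p) * bvec ((l + p) mod (2 * \<nu>), m + q) c) else (\<lambda>c. 0))"
proof -
  have "amult (radford_alg \<nu> :: ('k, _) based_alg) (bvec (l, m)) (bvec (p, q)) =
    (\<lambda>c. if c \<in> basis (radford_alg \<nu> :: ('k, _) based_alg)
      then mult_coeff (radford_alg \<nu> :: ('k, _) based_alg) (l, m) (p, q) c else 0)"
    using assms by (intro amult_bvec) (auto simp: radford_basis)
  then show ?thesis using assms by (auto simp: radford_basis radford_alg_def bvec_def fun_eq_iff)
qed

lemma neg_one_power_mod: "(- 1 :: 'k::field) ^ (k mod (2 * \<nu>)) = (- 1) ^ k"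
proof -
  have "even (k mod (2 * \<nu>)) \<longleftrightarrow> even k" by (simp add: dvd_mod_iff)
  then show ?thesis by (metis neg_one_even_power neg_one_odd_power)
qed

lemma radford_assoc_algebra:
  assumes "0 < \<nu>"
  shows "assoc_algebra (radford_alg \<nu> :: ('k::field, _) based_alg)"
proof -
  let ?A = "radford_alg \<nu> :: ('k, _) based_alg"
  have fin: "finite (basis ?A)" by (simp add: radford_basis)
  have b: "amult ?A (amult ?A (bvec a) (bvec b)) (bvec c) = amult ?A (bvec a) (amult ?A (bvec b) (bvec c))"
    if "a \<in> basis ?A" "b \<in> basis ?A" "c \<in> basis ?A" for a b c
    using that assms
    by (cases a; cases b; cases c)
       (auto simp: radford_basis radford_mult amult_linear fun_eq_iff neg_one_power_mod less_2_cases_iff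
          mod_simps power_add add.assoc)
  have "amult ?A (amult ?A u v) w = amult ?A u (amult ?A v w)"
    if "u \<in> elems ?A" "v \<in> elems ?A" "w \<in> elems ?A" for u v w
    apply (rule linear_ext[OF fin, of u])
    using that apply (auto simp: elems_def amult_linear)[5]
    apply (rule linear_ext[OF fin, of v])
    using that apply (auto simp: elems_def amult_linear)[5]
    apply (rule linear_ext[OF fin, of w])
    using that b by (auto simp: elems_def amult_linear)
  moreover have "amult ?A (unit ?A) u = u" if "u \<in> elems ?A" for u
    apply (rule linear_ext[OF fin, of u])
    using that assms by (auto simp: elems_def amult_linear radford_unit radford_mult radford_basis)
  moreover have "amult ?A u (unit ?A) = u" if "u \<in> elems ?A" for u
    apply (rule linear_ext[OF fin, of u])
    using that assms by (auto simp: elems_def amult_linear radford_unit radford_mult radford_basis)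
  ultimately show ?thesis
    using assms by (auto simp: assoc_algebra_def fin radford_unit bvec_elems radford_basis)
qed

lemma radford_apow:
  assumes "a < 2 * \<nu>"
  shows "apow (radford_alg \<nu>) (bvec (a, 0)) n = bvec ((a * n) mod (2 * \<nu>), 0)"
  using assms by (induction n) (auto simp: radford_unit radford_mult mod_simps)

lemma radford_apow_g: "0 < \<nu> \<Longrightarrow> apow (radford_alg \<nu>) rad_g n = bvec (n mod (2 * \<nu>), 0)"
  using radford_apow[of 1 \<nu> n] by (simp add: rad_g_def)

lemma apow_2: "apow A u 2 = amult A u (amult A u (unit A))"
  by (simp add: numeral_2_eq_2)

lemma radford_relations:
  assumes "0 < \<nu>"
  defines "A \<equiv> radford_alg \<nu> :: ('k::field, nat \<times> nat) based_alg"
  shows "apow A rad_g (2 * \<nu>) = unit A"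
    and "(\<lambda>b. amult A rad_g rad_x b + amult A rad_x rad_g b) = (\<lambda>b. 0)"
    and "apow A rad_x 2 = (\<lambda>b. 0)"
    and "l < 2 * \<nu> \<Longrightarrow> m < 2 \<Longrightarrow> amult A (apow A rad_g l) (apow A rad_x m) = bvec (l, m)"
proof -
  note [simp] = radford_apow_g[OF assms(1)] radford_unit
  show "apow A rad_g (2 * \<nu>) = unit A"
    by (simp add: A_def)
  show "(\<lambda>b. amult A rad_g rad_x b + amult A rad_x rad_g b) = (\<lambda>b. 0)" "apow A rad_x 2 = (\<lambda>b. 0)"
    using assms(1) by (simp_all add: A_def rad_g_def rad_x_def radford_mult amult_linear apow_2)
  show "amult A (apow A rad_g l) (apow A rad_x m) = bvec (l, m)" if "l < 2 * \<nu>" "m < 2"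
    using that assms(1) by (auto simp: A_def rad_x_def radford_mult less_2_cases_iff)
qed

subsection \<open>The Hopf algebra axioms\<close>

lemma radford_hopf_sel:
  "basis (radford_hopf \<nu>) = {..<2 * \<nu>} \<times> {..<2}"
  "unit (radford_hopf \<nu>) = bvec (0, 0)"
  by (simp_all add: radford_hopf_def radford_alg_def Let_def)

lemma radford_hopf_amult: "amult (radford_hopf \<nu>) = amult (radford_alg \<nu>)"
  by (simp add: radford_hopf_def Let_def amult_def fun_eq_iff)

lemma radford_hopf_elems: "elems (radford_hopf \<nu>) = elems (radford_alg \<nu>)"
  by (simp add: radford_hopf_def Let_def elems_def)

lemma radford_hopf_tensor: "radford_hopf \<nu> \<otimes>\<^sub>a radford_hopf \<nu> = radford_alg \<nu> \<otimes>\<^sub>a radford_alg \<nu>"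
  by (simp add: radford_hopf_def Let_def tensor_alg_def)

lemma tensor_unit: "unit (A \<otimes>\<^sub>a B) = unit A \<otimes>\<^sub>v unit B"
  by (simp add: tensor_alg_def)

lemma apow_tensor: "apow (A \<otimes>\<^sub>a B) (u \<otimes>\<^sub>v v) n = apow A u n \<otimes>\<^sub>v apow B v n"
  by (induction n) (simp_all add: tensor_unit amult_tensor)

lemma radford_comult:
  assumes "0 < \<nu>" "l < 2 * \<nu>"
  shows "comult (radford_hopf \<nu>) (bvec (l, 0)) = bvec (l, 0) \<otimes>\<^sub>v (bvec (l, 0) :: _ \<Rightarrow> 'k::field)"
    and "comult (radford_hopf \<nu>) (bvec (l, Suc 0)) =
      (\<lambda>p. (bvec (l, Suc 0) \<otimes>\<^sub>v bvec ((l + \<nu>) mod (2 * \<nu>), 0)) p + (bvec (l, 0) \<otimes>\<^sub>v bvec (l, Suc 0)) p :: 'k)"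
    and "counit (radford_hopf \<nu>) (bvec (l, 0)) = (1 :: 'k)"
    and "counit (radford_hopf \<nu>) (bvec (l, Suc 0)) = (0 :: 'k)"
    and "antipode (radford_hopf \<nu>) (bvec (l, 0)) = (bvec ((2 * \<nu> - 1) * l mod (2 * \<nu>), 0) :: _ \<Rightarrow> 'k)"
    and "antipode (radford_hopf \<nu>) (bvec (l, Suc 0)) =
      (\<lambda>c. (- 1) ^ l * bvec ((\<nu> + (2 * \<nu> - 1) * l) mod (2 * \<nu>), Suc 0) c :: 'k)"
proof -
  have f: "finite (basis (radford_hopf \<nu> :: ('k, _) based_hopf))"
    and b: "(l, 0) \<in> basis (radford_hopf \<nu> :: ('k, _) based_hopf)"
      "(l, Suc 0) \<in> basis (radford_hopf \<nu> :: ('k, _) based_hopf)"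
    using assms by (auto simp: radford_hopf_sel)
  have e: "(- 1 :: 'k) ^ ((2 * \<nu> - 1) * l) = (- 1) ^ l"
    using assms(1) by (simp add: power_mult)
  note s = structure_bvec[OF f b(1)] structure_bvec[OF f b(2)]
  show "comult (radford_hopf \<nu>) (bvec (l, 0)) = bvec (l, 0) \<otimes>\<^sub>v (bvec (l, 0) :: _ \<Rightarrow> 'k)"
    "comult (radford_hopf \<nu>) (bvec (l, Suc 0)) =
      (\<lambda>p. (bvec (l, Suc 0) \<otimes>\<^sub>v bvec ((l + \<nu>) mod (2 * \<nu>), 0)) p + (bvec (l, 0) \<otimes>\<^sub>v bvec (l, Suc 0)) p :: 'k)"
    "counit (radford_hopf \<nu>) (bvec (l, 0)) = (1 :: 'k)"
    "counit (radford_hopf \<nu>) (bvec (l, Suc 0)) = (0 :: 'k)"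
    "antipode (radford_hopf \<nu>) (bvec (l, 0)) = (bvec ((2 * \<nu> - 1) * l mod (2 * \<nu>), 0) :: _ \<Rightarrow> 'k)"
    "antipode (radford_hopf \<nu>) (bvec (l, Suc 0)) =
      (\<lambda>c. (- 1) ^ l * bvec ((\<nu> + (2 * \<nu> - 1) * l) mod (2 * \<nu>), Suc 0) c :: 'k)"
    unfolding s using assms
    by (simp_all add: radford_hopf_def Let_def tensor_unit apow_tensor radford_apow_g rad_x_def radford_apow
        radford_unit amult_linear amult_tensor radford_mult neg_one_power_mod e e[unfolded One_nat_def] mod_simps)
qed

lemma elemsD: "u \<in> elems A \<Longrightarrow> b \<notin> basis A \<Longrightarrow> u b = 0"
  by (simp add: elems_def)

lemma linear_ext_elems:
  fixes F G :: "('b \<Rightarrow> 'k::field) \<Rightarrow> 'c \<Rightarrow> 'k"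
  assumes "u \<in> elems A" "finite (basis A)"
    and "\<And>u v. F (\<lambda>x. u x + v x) = (\<lambda>p. F u p + F v p)" "\<And>c u. F (\<lambda>x. c * u x) = (\<lambda>p. c * F u p)"
    and "\<And>u v. G (\<lambda>x. u x + v x) = (\<lambda>p. G u p + G v p)" "\<And>c u. G (\<lambda>x. c * u x) = (\<lambda>p. c * G u p)"
    and "\<And>b. b \<in> basis A \<Longrightarrow> F (bvec b) = G (bvec b)"
  shows "F u = G u"
  using assms by (intro linear_ext[of "basis A" u F G]) (auto dest: elemsD)

lemma comult_fst_linear:
  "comult_fst H (\<lambda>x. u x + u' x) = (\<lambda>p. comult_fst H u p + comult_fst H u' p)"
  "comult_fst H (\<lambda>x. c * u x) = (\<lambda>p. c * comult_fst H u p)"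
  "comult_fst H (v \<otimes>\<^sub>v w) = (\<lambda>(a, b, c). (comult H v \<otimes>\<^sub>v w) ((a, b), c))"
  by (auto simp: comult_fst_def comult_def tensor_vec_def fun_eq_iff algebra_simps sum.distrib sum_distrib_left)

lemma comult_snd_linear:
  "comult_snd H (\<lambda>x. u x + u' x) = (\<lambda>p. comult_snd H u p + comult_snd H u' p)"
  "comult_snd H (\<lambda>x. c * u x) = (\<lambda>p. c * comult_snd H u p)"
  "comult_snd H (v \<otimes>\<^sub>v w) = v \<otimes>\<^sub>v comult H w"
  by (auto simp: comult_snd_def comult_def tensor_vec_def fun_eq_iff algebra_simps sum.distrib sum_distrib_left)

lemma radford_comult_mult:
  assumes "odd \<nu>" and "u \<in> elems (radford_hopf \<nu>)" and "v \<in> elems (radford_hopf \<nu> :: ('k::field, _) based_hopf)"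
  defines "H \<equiv> radford_hopf \<nu> :: ('k, _) based_hopf"
  shows "comult H (amult H u v) = amult (H \<otimes>\<^sub>a H) (comult H u) (comult H v)"
proof -
  have n: "0 < \<nu>" using assms(1) by (rule odd_pos)
  have fin: "finite (basis H)" by (simp add: H_def radford_hopf_sel)
  have s: "(- 1 :: 'k) ^ ((p + \<nu>) mod (2 * \<nu>)) = - ((- 1) ^ p)" for p
    using assms(1) by (simp add: neg_one_power_mod power_add)
  have b: "comult H (amult H (bvec a) (bvec b)) = amult (H \<otimes>\<^sub>a H) (comult H (bvec a)) (comult H (bvec b))"
    if "a \<in> basis H" "b \<in> basis H" for a b
    using that n
    by (cases a; cases b)
       (auto simp: H_def radford_hopf_sel radford_hopf_amult radford_hopf_tensor radford_comult
          less_2_cases_iff radford_mult amult_linear amult_tensor tensor_vec_linear comult_linear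
          mod_simps s s[unfolded mult.commute[of 2]] neg_one_power_mod fun_eq_iff algebra_simps)
  show ?thesis
    apply (rule linear_ext_elems[OF assms(2)[folded H_def] fin])
        apply (simp_all add: amult_linear comult_linear)
    apply (rule linear_ext_elems[OF assms(3)[folded H_def] fin])
        apply (simp_all add: amult_linear comult_linear b)
    done
qed

lemma radford_hopf_algebra:
  assumes "odd \<nu>"
  shows "hopf_algebra (radford_hopf \<nu> :: ('k::field, _) based_hopf)"
proof -
  let ?H = "radford_hopf \<nu> :: ('k, _) based_hopf"
  have n: "0 < \<nu>" using assms by (rule odd_pos)
  have fin: "finite (basis ?H)" by (simp add: radford_hopf_sel)
  have ring: "assoc_algebra ?H"
  proof -
    have "assoc_algebra (radford_alg \<nu> :: ('k, _) based_alg)" by (rule radford_assoc_algebra[OF n])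
    then show ?thesis
      by (simp add: assoc_algebra_def radford_hopf_elems radford_hopf_amult radford_hopf_sel radford_basis radford_unit)
  qed
  have basE: "\<exists>l<2 * \<nu>. b = (l, 0) \<or> b = (l, Suc 0)" if "b \<in> basis ?H" for b
    using that by (cases b) (auto simp: radford_hopf_sel less_2_cases_iff)
  have unit: "comult ?H (unit ?H) = unit (?H \<otimes>\<^sub>a ?H)" "counit ?H (unit ?H) = 1"
    using n by (simp_all add: radford_hopf_sel tensor_unit radford_comult)
  have "comult_bas ?H b \<in> elems (?H \<otimes>\<^sub>a ?H)" for b
    unfolding radford_hopf_tensor by (cases b) (simp add: radford_hopf_def Let_def amult_elems)
  then have comult_in: "comult ?H u \<in> elems (?H \<otimes>\<^sub>a ?H)" for u
    by (auto simp: elems_def comult_def)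
  have "antipode_bas ?H b \<in> elems ?H" for b
    unfolding radford_hopf_elems by (cases b) (simp add: radford_hopf_def Let_def amult_elems)
  then have antipode_in: "antipode ?H u \<in> elems ?H" for u
    by (auto simp: elems_def antipode_def)
  have counit_mult: "counit ?H (amult ?H u v) = counit ?H u * counit ?H v"
    if "u \<in> elems ?H" "v \<in> elems ?H" for u v
  proof -
    have b: "counit ?H (amult ?H (bvec a) (bvec b)) = counit ?H (bvec a) * counit ?H (bvec b)"
      if "a \<in> basis ?H" "b \<in> basis ?H" for a b
      using basE[OF that(1)] basE[OF that(2)] n
      by (auto simp: radford_hopf_amult radford_mult radford_comult counit_linear)
    have "(\<lambda>_::unit. counit ?H (amult ?H u v)) = (\<lambda>_. counit ?H u * counit ?H v)"
      apply (rule linear_ext_elems[OF that(1) fin])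
          apply (simp_all add: amult_linear counit_linear algebra_simps)
      apply (rule linear_ext_elems[OF that(2) fin])
          apply (simp_all add: amult_linear counit_linear algebra_simps b)
      done
    then show ?thesis by (simp add: fun_eq_iff)
  qed
  have coassoc: "comult_fst ?H (comult ?H u) = comult_snd ?H (comult ?H u)" if "u \<in> elems ?H" for u
  proof (rule linear_ext_elems[OF that fin])
    fix b assume "b \<in> basis ?H"
    then show "comult_fst ?H (comult ?H (bvec b)) = comult_snd ?H (comult ?H (bvec b))"
      using basE[of b] n
      by (auto simp: radford_comult comult_fst_linear comult_snd_linear tensor_vec_linear mod_simps)
         (auto simp: tensor_vec_def fun_eq_iff algebra_simps)
  qed (simp_all add: comult_linear comult_fst_linear comult_snd_linear)
  have counit_id: "(\<Sum>c\<in>basis ?H. (v \<otimes>\<^sub>v w) (c, b) * counit_bas ?H c) = counit ?H v * w b"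
    "(\<Sum>c\<in>basis ?H. (v \<otimes>\<^sub>v w) (b, c) * counit_bas ?H c) = counit ?H w * v b" for v w b
    by (simp_all add: counit_def tensor_vec_def sum_distrib_left sum_distrib_right mult_ac)
  have counit_l: "(\<lambda>b. \<Sum>a\<in>basis ?H. comult ?H u (a, b) * counit_bas ?H a) = u" if "u \<in> elems ?H" for u
  proof (rule linear_ext_elems[OF that fin])
    fix c assume "c \<in> basis ?H"
    then show "(\<lambda>b. \<Sum>a\<in>basis ?H. comult ?H (bvec c) (a, b) * counit_bas ?H a) = bvec c"
      using basE[of c] n
      by (auto simp: radford_comult counit_id distrib_right sum.distrib)
  qed (simp_all add: comult_linear algebra_simps sum.distrib sum_distrib_left)
  have counit_r: "(\<lambda>b. \<Sum>a\<in>basis ?H. comult ?H u (b, a) * counit_bas ?H a) = u" if "u \<in> elems ?H" for u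
  proof (rule linear_ext_elems[OF that fin])
    fix c assume "c \<in> basis ?H"
    then show "(\<lambda>b. \<Sum>a\<in>basis ?H. comult ?H (bvec c) (b, a) * counit_bas ?H a) = bvec c"
      using basE[of c] n
      by (auto simp: radford_comult counit_id distrib_right sum.distrib)
  qed (simp_all add: comult_linear algebra_simps sum.distrib sum_distrib_left)
  have conv_l: "(\<Sum>(a, b)\<in>basis ?H \<times> basis ?H. (bvec p \<otimes>\<^sub>v bvec q) (a, b) * f a b) = f p q"
    if "p \<in> basis ?H" "q \<in> basis ?H" for p q and f :: "_ \<Rightarrow> _ \<Rightarrow> 'k"
  proof -
    have "(\<Sum>(a, b)\<in>basis ?H \<times> basis ?H. (bvec p \<otimes>\<^sub>v bvec q) (a, b) * f a b) =
      (\<Sum>x\<in>basis ?H \<times> basis ?H. if x = (p, q) then f p q else 0)"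
      by (intro sum.cong) (auto simp: tensor_vec_def bvec_def split: if_splits)
    then show ?thesis using that fin by simp
  qed
  have inv: "((2 * \<nu> - Suc 0) * l + l) mod (2 * \<nu>) = 0" "(l + (2 * \<nu> - Suc 0) * l) mod (2 * \<nu>) = 0" for l
  proof -
    have "(2 * \<nu> - Suc 0) * l + l = 2 * \<nu> * l"
      using n by (cases \<nu>) (auto simp: algebra_simps)
    then show "((2 * \<nu> - Suc 0) * l + l) mod (2 * \<nu>) = 0" "(l + (2 * \<nu> - Suc 0) * l) mod (2 * \<nu>) = 0"
      by (simp_all add: add.commute[of l])
  qed
  have inv_x: "(\<nu> + (2 * \<nu> - Suc 0) * l + (l + \<nu>)) mod (2 * \<nu>) = 0" for l
  proof -
    have "\<nu> + (2 * \<nu> - Suc 0) * l + (l + \<nu>) = 2 * \<nu> * Suc l"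
      using n by (cases \<nu>) (auto simp: algebra_simps)
    then show ?thesis by (simp only: mod_mult_self1_is_0)
  qed
  have sgn: "(- 1) ^ l * ((- 1) ^ l * y) = y" for l and y :: 'k
    by (simp add: mult.assoc[symmetric] power_mult_distrib[symmetric])
  have inv_x': "(l + (2 * \<nu> - Suc 0) * (l + \<nu>)) mod (2 * \<nu>) = \<nu>" "(l + (\<nu> + (2 * \<nu> - Suc 0) * l)) mod (2 * \<nu>) = \<nu>"
    for l
  proof -
    have "l + (2 * \<nu> - Suc 0) * (l + \<nu>) = \<nu> + 2 * \<nu> * (l + \<nu> - 1)"
      "l + (\<nu> + (2 * \<nu> - Suc 0) * l) = \<nu> + 2 * \<nu> * l"
      using n by (cases \<nu>; auto simp: algebra_simps)+
    then show "(l + (2 * \<nu> - Suc 0) * (l + \<nu>)) mod (2 * \<nu>) = \<nu>"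
      "(l + (\<nu> + (2 * \<nu> - Suc 0) * l)) mod (2 * \<nu>) = \<nu>"
      using n by (simp_all only: mod_mult_self2) simp_all
  qed
  have sgn': "(- 1 :: 'k) ^ ((2 * \<nu> - Suc 0) * (l + \<nu>)) = - ((- 1) ^ l)" for l
    using n assms by (simp add: power_mult power_add)
  define C where "C f Q = (\<lambda>c. \<Sum>(a, b)\<in>basis ?H \<times> basis ?H. Q (a, b) * f a b c)"
    for f :: "_ \<Rightarrow> _ \<Rightarrow> nat \<times> nat \<Rightarrow> 'k" and Q
  have C: "C f (\<lambda>x. u x + v x) = (\<lambda>p. C f u p + C f v p)" "C f (\<lambda>x. c * u x) = (\<lambda>p. c * C f u p)" for f u v c
    by (simp_all add: C_def split_beta algebra_simps sum.distrib sum_distrib_left)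
  have C_bvec: "C f (bvec p \<otimes>\<^sub>v bvec q) = f p q" if "p \<in> basis ?H" "q \<in> basis ?H" for f p q
    using conv_l[OF that] by (simp add: C_def)
  have in_basis: "(k mod (2 * \<nu>), m) \<in> basis ?H \<longleftrightarrow> m < 2" "(k, m) \<in> basis ?H \<longleftrightarrow> k < 2 * \<nu> \<and> m < 2" for k m
    using n by (simp_all add: radford_hopf_sel)
  have antip_l: "C (\<lambda>a b. amult ?H (antipode ?H (bvec a)) (bvec b)) (comult ?H u) = (\<lambda>c. counit ?H u * unit ?H c)"
    if "u \<in> elems ?H" for u
  proof (rule linear_ext_elems[OF that fin])
    fix p assume "p \<in> basis ?H"
    then show "C (\<lambda>a b. amult ?H (antipode ?H (bvec a)) (bvec b)) (comult ?H (bvec p)) =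
        (\<lambda>c. counit ?H (bvec p) * unit ?H c)"
      using basE[of p] n assms
      by (auto simp: C C_bvec in_basis radford_comult radford_hopf_sel(2) radford_hopf_amult amult_linear
          radford_mult neg_one_power_mod mod_simps inv inv_x power_add sgn)
  qed (simp_all add: C comult_linear counit_linear algebra_simps)
  have antip_r: "C (\<lambda>a b. amult ?H (bvec a) (antipode ?H (bvec b))) (comult ?H u) = (\<lambda>c. counit ?H u * unit ?H c)"
    if "u \<in> elems ?H" for u
  proof (rule linear_ext_elems[OF that fin])
    fix p assume "p \<in> basis ?H"
    then show "C (\<lambda>a b. amult ?H (bvec a) (antipode ?H (bvec b))) (comult ?H (bvec p)) =
        (\<lambda>c. counit ?H (bvec p) * unit ?H c)"
      using basE[of p] n assms
      by (auto simp: C C_bvec in_basis radford_comult radford_hopf_sel(2) radford_hopf_amult amult_linear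
          radford_mult neg_one_power_mod mod_simps inv inv_x' sgn')
  qed (simp_all add: C comult_linear counit_linear algebra_simps)
  show ?thesis
    unfolding hopf_algebra_def
    by (intro conjI ballI)
       (rule ring unit comult_in antipode_in radford_comult_mult[OF assms] counit_mult coassoc counit_l counit_r
          antip_l[unfolded C_def] antip_r[unfolded C_def]; assumption)+
qed

subsection \<open>The universal property of the presentation\<close>

text \<open>
  The target of the homomorphisms is an arbitrary \<open>k\<close>-algebra, that is, a ring of type \<open>'a\<close> with a
  scalar multiplication that makes it a vector space and the product bilinear.
\<close>

definition k_algebra :: "('k::field \<Rightarrow> 'a::ring_1 \<Rightarrow> 'a) \<Rightarrow> bool" where
  "k_algebra scale \<longleftrightarrow> vector_space scale \<and>
     (\<forall>c x y. scale c x * y = scale c (x * y) \<and> x * scale c y = scale c (x * y))"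

definition algebra_hom ::
  "('k::field, 'b, 'm) based_alg_scheme \<Rightarrow> ('k \<Rightarrow> 'a::ring_1 \<Rightarrow> 'a) \<Rightarrow> (('b \<Rightarrow> 'k) \<Rightarrow> 'a) \<Rightarrow> bool" where
  "algebra_hom A scale \<phi> \<longleftrightarrow> \<phi> (unit A) = 1 \<and>
     (\<forall>u\<in>elems A. \<forall>v\<in>elems A. \<phi> (\<lambda>b. u b + v b) = \<phi> u + \<phi> v \<and> \<phi> (amult A u v) = \<phi> u * \<phi> v) \<and>
     (\<forall>c. \<forall>u\<in>elems A. \<phi> (\<lambda>b. c * u b) = scale c (\<phi> u))"

lemma radford_universal:
  fixes scale :: "'k::field \<Rightarrow> 'a::ring_1 \<Rightarrow> 'a"
  assumes "0 < \<nu>" and alg: "k_algebra scale"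
    and rel: "G ^ (2 * \<nu>) = 1" "G * X + X * G = 0" "X\<^sup>2 = 0"
  shows "\<exists>\<phi>. algebra_hom (radford_alg \<nu>) scale \<phi> \<and> \<phi> rad_g = G \<and> \<phi> rad_x = X"
proof -
  let ?A = "radford_alg \<nu> :: ('k, _) based_alg"
  interpret vector_space scale using alg by (simp add: k_algebra_def)
  have sc: "scale c x * y = scale c (x * y)" "x * scale c y = scale c (x * y)" for c x y
    using alg by (auto simp: k_algebra_def)
  have fin: "finite (basis ?A)" by (simp add: radford_basis)
  define M where "M p = G ^ fst p * X ^ snd p" for p :: "nat \<times> nat"
  define \<phi> where "\<phi> u = (\<Sum>b\<in>basis ?A. scale (u b) (M b))" for u
  have XG: "X * G = - (G * X)"
    using rel(2) by (metis add.commute eq_neg_iff_add_eq_0)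
  have XGp: "X * G ^ p = scale ((- 1) ^ p) (G ^ p * X)" for p
  proof (induction p)
    case (Suc p)
    have "X * G ^ Suc p = - (G * (X * G ^ p))"
      by (simp add: XG mult.assoc[symmetric])
    then show ?case by (simp add: Suc sc mult.assoc)
  qed simp
  have Gmod: "G ^ (n mod (2 * \<nu>)) = G ^ n" for n
  proof -
    have "G ^ n = G ^ (2 * \<nu> * (n div (2 * \<nu>)) + n mod (2 * \<nu>))" by simp
    also have "\<dots> = G ^ (n mod (2 * \<nu>))" using power_mult[of G "2 * \<nu>" "n div (2 * \<nu>)"] by (simp only: power_add rel(1) power_one mult_1)
    finally show ?thesis by simp
  qed
  have \<phi>_bvec: "\<phi> (bvec b) = M b" if "b \<in> basis ?A" for b
    using that fin by (simp add: \<phi>_def bvec_def if_distrib[of "\<lambda>t. scale t _"] cong: if_cong)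
  have \<phi>_lin: "\<phi> (\<lambda>b. u b + v b) = \<phi> u + \<phi> v" "\<phi> (\<lambda>b. c * u b) = scale c (\<phi> u)" "\<phi> (\<lambda>b. 0) = 0" for u v c
    by (simp_all add: \<phi>_def scale_left_distrib sum.distrib scale_sum_right)
  have b: "\<phi> (amult ?A (bvec a) (bvec b)) = M a * M b" if "a \<in> basis ?A" "b \<in> basis ?A" for a b
  proof -
    obtain l m p q where ab: "a = (l, m)" "b = (p, q)" by (cases a; cases b)
    have bd: "l < 2 * \<nu>" "p < 2 * \<nu>" "m < 2" "q < 2" using that ab by (auto simp: radford_basis)
    have "M a * M b = (if m + q < 2 then scale ((- 1) ^ (m * p)) (M ((l + p) mod (2 * \<nu>), m + q)) else 0)"
    proof (cases "m = 0")
      case True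
      then show ?thesis using bd by (simp add: M_def ab Gmod power_add mult.assoc)
    next
      case False
      then have m: "m = 1" using bd by simp
      have "M a * M b = G ^ l * (X * G ^ p) * X ^ q" by (simp add: M_def ab m mult.assoc)
      also have "\<dots> = scale ((- 1) ^ p) (G ^ (l + p) * X ^ Suc q)"
        by (simp add: XGp sc mult.assoc power_add)
      finally show ?thesis using bd rel(3)
        by (auto simp: M_def ab m Gmod less_2_cases_iff power2_eq_square)
    qed
    then show ?thesis
      using bd assms(1) by (simp add: ab radford_mult \<phi>_lin \<phi>_bvec radford_basis)
  qed
  have mult: "\<phi> (amult ?A u v) = \<phi> u * \<phi> v" for u v
  proof -
    have sum: "\<phi> (\<lambda>c. \<Sum>i\<in>I. f i * g i c) = (\<Sum>i\<in>I. scale (f i) (\<phi> (g i)))"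
      if "finite I" for I :: "(nat \<times> nat) set" and f g
      using that by (induction I rule: finite_induct) (simp_all add: \<phi>_lin)
    have "amult ?A u v =
        (\<lambda>c. \<Sum>i\<in>basis ?A. u i * (\<Sum>j\<in>basis ?A. v j * amult ?A (bvec i) (bvec j) c))"
      by (auto simp: amult_def[of ?A u v] amult_bvec[OF fin] fun_eq_iff sum_distrib_left mult_ac intro!: sum.cong)
    then have "\<phi> (amult ?A u v) = (\<Sum>i\<in>basis ?A. \<Sum>j\<in>basis ?A. scale (u i) (scale (v j) (M i * M j)))"
      using b by (simp add: sum fin scale_sum_right del: scale_scale)
    also have "\<dots> = \<phi> u * \<phi> v"
      by (simp add: \<phi>_def sum_product sc mult.commute)
    finally show ?thesis .
  qed
  have "(0, 0) \<in> basis ?A" "(1, 0) \<in> basis ?A" "(0, 1) \<in> basis ?A"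
    using assms(1) by (auto simp: radford_basis)
  then have "\<phi> (unit ?A) = 1" "\<phi> rad_g = G" "\<phi> rad_x = X"
    by (simp_all add: radford_unit rad_g_def rad_x_def \<phi>_bvec M_def)
  then show ?thesis
    using mult \<phi>_lin by (intro exI[of _ \<phi>]) (auto simp: algebra_hom_def)
qed

lemma radford_universal_unique:
  fixes scale :: "'k::field \<Rightarrow> 'a::ring_1 \<Rightarrow> 'a"
  assumes "0 < \<nu>" "k_algebra scale"
    and hom: "algebra_hom (radford_alg \<nu>) scale \<phi>" "algebra_hom (radford_alg \<nu>) scale \<psi>"
    and eq: "\<phi> rad_g = \<psi> rad_g" "\<phi> rad_x = \<psi> rad_x"
    and u: "u \<in> elems (radford_alg \<nu>)"
  shows "\<phi> u = \<psi> u"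
proof -
  let ?A = "radford_alg \<nu> :: ('k, _) based_alg"
  interpret vector_space scale using assms(2) by (simp add: k_algebra_def)
  have fin: "finite (basis ?A)" by (simp add: radford_basis)
  have unit_in: "unit ?A \<in> elems ?A" and g_in: "rad_g \<in> elems ?A" and x_in: "rad_x \<in> elems ?A"
    using assms(1) by (simp_all add: radford_unit rad_g_def rad_x_def bvec_elems radford_basis)
  have pow_in: "apow ?A v n \<in> elems ?A" for v n
    by (cases n) (simp_all add: unit_in amult_elems)
  have pow: "\<chi> (apow ?A v n) = \<chi> v ^ n" if "algebra_hom ?A scale \<chi>" "v \<in> elems ?A" for \<chi> v n
    using that pow_in by (induction n) (auto simp: algebra_hom_def)
  have mult: "\<chi> (amult ?A v w) = \<chi> v * \<chi> w" if "algebra_hom ?A scale \<chi>" "v \<in> elems ?A" "w \<in> elems ?A" for \<chi> v w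
    using that by (auto simp: algebra_hom_def)
  have b: "\<phi> (bvec p) = \<psi> (bvec p)" if "p \<in> basis ?A" for p
  proof -
    obtain l m where p: "p = (l, m)" "l < 2 * \<nu>" "m < 2"
      using \<open>p \<in> basis ?A\<close> by (cases p) (auto simp: radford_basis)
    show ?thesis
      unfolding p(1) radford_relations(4)[OF assms(1) p(2,3), symmetric]
      by (simp add: mult pow hom pow_in g_in x_in eq)
  qed
  have lin: "\<chi> (\<lambda>c. \<Sum>i\<in>I. u i * bvec i c) = (\<Sum>i\<in>I. scale (u i) (\<chi> (bvec i)))"
    if "algebra_hom ?A scale \<chi>" "finite I" "I \<subseteq> basis ?A" for \<chi> I
    using that(2,3)
  proof (induction I rule: finite_induct)
    case empty
    have "\<chi> (\<lambda>b. 0 * unit ?A b) = scale 0 (\<chi> (unit ?A))"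
      using that(1) unit_in unfolding algebra_hom_def by blast
    then show ?case by simp
  next
    case (insert i I)
    have "(\<lambda>c. u i * bvec i c) \<in> elems ?A" "(\<lambda>c. \<Sum>i\<in>I. u i * bvec i c) \<in> elems ?A" "bvec i \<in> elems ?A"
      using insert.prems by (auto simp: elems_def bvec_def intro!: sum.neutral)
    then show ?case
      using insert that(1) by (simp add: algebra_hom_def)
  qed
  have "u = (\<lambda>c. \<Sum>i\<in>basis ?A. u i * bvec i c)"
    using bvec_expand[OF fin] u by (auto dest: elemsD)
  then have e: "\<chi> u = (\<Sum>i\<in>basis ?A. scale (u i) (\<chi> (bvec i)))" if "algebra_hom ?A scale \<chi>" for \<chi>
    using lin[OF that fin order_refl] by simp
  show ?thesis unfolding e[OF hom(1)] e[OF hom(2)] by (intro sum.cong refl) (simp add: b)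
qed

end

theory Submission
  imports Defs
begin

text \<open>
  Everything becomes a pointwise computation after a change of basis. Put \<open>N = 2\<nu>\<close>. The idempotents
  \<open>e\<^sub>l = 1/N \<Sum>\<^sub>i \<omega>\<^sup>-\<^sup>i\<^sup>l g\<^sup>i\<close> diagonalise \<open>g\<close>, with \<open>g e\<^sub>l = \<omega>\<^sup>l e\<^sub>l\<close>, and since \<open>\<omega>\<^sup>\<nu> = -1\<close> the
  relation \<open>g x = - x g\<close> turns into a shift of indices, \<open>x e\<^sub>m = e\<^bsub>m + \<nu>\<^esub> x\<close>. Therefore
  \<open>(e\<^sub>l x\<^sup>a) (e\<^sub>m x\<^sup>b)\<close> is \<open>e\<^sub>l x\<^bsup>a + b\<^esup>\<close> if \<open>m \<equiv> l + a \<nu>\<close> modulo \<open>N\<close> and \<open>0\<close> otherwise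
  (\<open>eig_mult\<close>). In a tensor power of \<open>H\<close>, linear combinations of the vectors
  \<open>e\<^sub>l x\<^sup>a \<otimes> e\<^sub>m x\<^sup>b \<otimes> \<dots>\<close> with fixed exponents are then multiplied by multiplying their coefficient
  functions, the second one shifted, and adding the exponents (\<open>eig2_mult\<close>, \<open>eig3_mult\<close>).

  With the bicharacter \<open>\<chi>(l, m) = \<omega>\<^bsup>s l m\<^esup>\<close> the matrix reads
  \<open>R = \<Sum> \<chi>(l, m) e\<^sub>l \<otimes> e\<^sub>m + \<beta> \<Sum> \<chi>(l, m) (-1)\<^sup>m e\<^sub>l x \<otimes> e\<^sub>m x\<close> (\<open>R_eig\<close>). Drinfeld's axioms and the
  formula for the inverse reduce to the bicharacter property of \<open>\<chi>\<close> and to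
  \<open>\<chi>(l + \<nu>, m) = \<chi>(l, m) (-1)\<^sup>m\<close>, which is where \<open>s\<close> odd enters.

  For \<open>R\<^sub>1\<^sub>2 R\<^sub>3\<^sub>1\<^sup>-\<^sup>1 R\<^sub>2\<^sub>3 = R\<^sub>2\<^sub>3 R\<^sub>3\<^sub>1\<^sup>-\<^sup>1 R\<^sub>1\<^sub>2\<close> compare powers of \<open>\<beta>\<close>. The terms without \<open>\<beta>\<close> lie in the
  commutative algebra generated by \<open>g\<close>. Any two of the three factors meet in a tensor slot, so the
  terms with \<open>\<beta>\<^sup>2\<close> or \<open>\<beta>\<^sup>3\<close> contain \<open>x\<^sup>2 = 0\<close>. In a term linear in \<open>\<beta>\<close>, the two \<open>x\<close>'s of one factor
  have to be moved past the diagonal parts of the two other factors. One of these parts sees the shift of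
  the first \<open>x\<close>, the other one that of the second \<open>x\<close>, and each contributes the same sign \<open>(-1)\<^sup>j\<close>, where
  \<open>j\<close> is the index of the slot without \<open>x\<close>. For \<open>R\<^sub>1\<^sub>2\<close> and \<open>R\<^sub>2\<^sub>3\<close> both signs occur on the same side of the
  equation and cancel; for \<open>R\<^sub>3\<^sub>1\<^sup>-\<^sup>1\<close>, in the middle, one occurs on each side (\<open>yang_baxter_R\<close>).
\<close>

section \<open>Linear and associative algebra in coordinates\<close>

lemma linear_map_sum:
  fixes F :: "('b \<Rightarrow> 'k::field) \<Rightarrow> 'c \<Rightarrow> 'k"
  assumes add: "\<And>u v. F (\<lambda>x. u x + v x) = (\<lambda>p. F u p + F v p)"
    and scale: "\<And>c u. F (\<lambda>x. c * u x) = (\<lambda>p. c * F u p)"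
    and fin: "finite I"
  shows "F (\<lambda>x. \<Sum>i\<in>I. f i * u i x) = (\<lambda>p. \<Sum>i\<in>I. f i * F (u i) p)"
  using fin
proof (induction I rule: finite_induct)
  case empty
  show ?case using scale[of 0 "\<lambda>_. 0"] by simp
next
  case (insert i I)
  then show ?case by (simp add: add scale)
qed

lemmas amult_sum_left = linear_map_sum[of "\<lambda>u. amult A u v" for A v, OF amult_linear(1,3)]
lemmas amult_sum_right = linear_map_sum[of "amult A v" for A v, OF amult_linear(2,4)]
lemmas comult_sum = linear_map_sum[of "comult H" for H, OF comult_linear(1,2)]
lemmas comult_fst_sum = linear_map_sum[of "comult_fst H" for H, OF comult_fst_linear(1,2)]
lemmas comult_snd_sum = linear_map_sum[of "comult_snd H" for H, OF comult_snd_linear(1,2)]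

text \<open>
  The shape of product common to \<open>H \<otimes> H\<close> and \<open>H \<otimes> H \<otimes> H\<close>: each basis vector \<open>e i\<close> is
  multiplied to something nonzero by a single partner \<open>f (\<sigma> i)\<close>, so the double sum collapses.
\<close>

lemma amult_matched_sums:
  assumes "finite I" and "\<And>i. i \<in> I \<Longrightarrow> \<sigma> i \<in> I"
    and "\<And>i j. i \<in> I \<Longrightarrow> j \<in> I \<Longrightarrow>
      amult A (e i) (f j) = (if j = \<sigma> i then h i else (\<lambda>_. 0))"
  shows "amult A (\<lambda>p. \<Sum>i\<in>I. c i * e i p) (\<lambda>p. \<Sum>j\<in>I. d j * f j p) =
    (\<lambda>p. \<Sum>i\<in>I. c i * d (\<sigma> i) * h i p)"
proof
  fix p
  have "amult A (\<lambda>p. \<Sum>i\<in>I. c i * e i p) (\<lambda>p. \<Sum>j\<in>I. d j * f j p) p =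
      (\<Sum>i\<in>I. c i * (\<Sum>j\<in>I. d j * amult A (e i) (f j) p))"
    by (simp add: amult_sum_left amult_sum_right assms(1))
  also have "\<dots> = (\<Sum>i\<in>I. c i * d (\<sigma> i) * h i p)"
  proof (rule sum.cong[OF refl])
    fix i assume i: "i \<in> I"
    have "(\<Sum>j\<in>I. d j * amult A (e i) (f j) p) = (\<Sum>j\<in>I. if j = \<sigma> i then d (\<sigma> i) * h i p else 0)"
      by (rule sum.cong) (simp_all add: assms(3) i)
    also have "\<dots> = d (\<sigma> i) * h i p" using assms(1,2) i by simp
    finally show "c i * (\<Sum>j\<in>I. d j * amult A (e i) (f j) p) = c i * d (\<sigma> i) * h i p" by simp
  qed
  finally show "amult A (\<lambda>p. \<Sum>i\<in>I. c i * e i p) (\<lambda>p. \<Sum>j\<in>I. d j * f j p) p =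
      (\<Sum>i\<in>I. c i * d (\<sigma> i) * h i p)" .
qed

lemma assoc_algebra_tensor:
  fixes A :: "('k::field, 'b, 'm) based_alg_scheme" and B :: "('k, 'c, 'n) based_alg_scheme"
  assumes A: "assoc_algebra A" and B: "assoc_algebra B"
  shows "assoc_algebra (A \<otimes>\<^sub>a B)"
proof -
  let ?T = "A \<otimes>\<^sub>a B"
  have basis: "basis ?T = basis A \<times> basis B" by (simp add: tensor_alg_def)
  have fin: "finite (basis ?T)" using A B by (simp add: basis assoc_algebra_def)
  have unit: "unit ?T \<in> elems ?T"
    using A B by (auto simp: assoc_algebra_def elems_def tensor_unit tensor_vec_def basis)
  have b: "amult ?T (amult ?T (bvec a) (bvec b)) (bvec c) = amult ?T (bvec a) (amult ?T (bvec b) (bvec c))"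
    if "a \<in> basis ?T" "b \<in> basis ?T" "c \<in> basis ?T" for a b c
    using that A B
    by (cases a; cases b; cases c)
       (auto simp: basis bvec_tensor amult_tensor assoc_algebra_def bvec_elems)
  have "amult ?T (amult ?T u v) w = amult ?T u (amult ?T v w)"
    if "u \<in> elems ?T" "v \<in> elems ?T" "w \<in> elems ?T" for u v w
    apply (rule linear_ext_elems[OF that(1) fin])
        apply (simp_all add: amult_linear)
    apply (rule linear_ext_elems[OF that(2) fin])
        apply (simp_all add: amult_linear)
    apply (rule linear_ext_elems[OF that(3) fin])
        apply (simp_all add: amult_linear b)
    done
  moreover have "amult ?T (unit ?T) u = u" if "u \<in> elems ?T" for u
  proof (rule linear_ext_elems[OF that fin])
    fix b assume "b \<in> basis ?T"
    then show "amult ?T (unit ?T) (bvec b) = bvec b"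
      using A B by (cases b)
        (auto simp: basis bvec_tensor tensor_unit amult_tensor assoc_algebra_def bvec_elems)
  qed (simp_all add: amult_linear)
  moreover have "amult ?T u (unit ?T) = u" if "u \<in> elems ?T" for u
  proof (rule linear_ext_elems[OF that fin])
    fix b assume "b \<in> basis ?T"
    then show "amult ?T (bvec b) (unit ?T) = bvec b"
      using A B by (cases b)
        (auto simp: basis bvec_tensor tensor_unit amult_tensor assoc_algebra_def bvec_elems)
  qed (simp_all add: amult_linear)
  ultimately show ?thesis using fin unit by (simp add: assoc_algebra_def)
qed

text \<open>
  Associativity makes the inverse unique, so that an explicit inverse of \<open>R\<close> is the one chosen by
  the definite description in the definition of pseudotriangularity.
\<close>

lemma inverse_unique:
  assumes "assoc_algebra A" "is_inverse A u v" "is_inverse A u v'"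
  shows "v = v'"
proof -
  have "v = amult A v (amult A u v')"
    using assms by (metis assoc_algebra_def is_inverse_def)
  also have "\<dots> = amult A (amult A v u) v'"
    using assms by (metis assoc_algebra_def is_inverse_def)
  also have "\<dots> = v'"
    using assms by (metis assoc_algebra_def is_inverse_def)
  finally show ?thesis .
qed

section \<open>Roots of unity and the eigenbasis of \<open>g\<close>\<close>

locale radford_root =
  fixes \<nu> :: nat and \<omega> :: "'k::field"
  assumes odd_nu: "odd \<nu>"
    and primitive: "primitive_root_of_unity (2 * \<nu>) \<omega>"
    and invertible: "of_nat (2 * \<nu>) \<noteq> (0 :: 'k)"
begin

abbreviation H :: "('k, nat \<times> nat) based_hopf" where "H \<equiv> radford_hopf \<nu>"

abbreviation N :: nat where "N \<equiv> 2 * \<nu>"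

definition scalar_N :: 'k where "scalar_N = of_nat N"

lemma scalar_N_nonzero: "scalar_N \<noteq> 0"
  using invertible by (simp add: scalar_N_def)

lemma N_pos: "0 < \<nu>" "0 < N"
  using odd_nu by (simp_all add: odd_pos)

lemma root_power: "\<omega> ^ N = 1" "\<omega> \<noteq> 0"
proof -
  show "\<omega> ^ N = 1" using primitive by (simp add: primitive_root_of_unity_def)
  then show "\<omega> \<noteq> 0" using N_pos by (auto simp: power_0_left)
qed

lemma root_power_mod: "\<omega> ^ (l mod N) = \<omega> ^ l"
proof -
  have "\<omega> ^ l = \<omega> ^ (N * (l div N) + l mod N)" by simp
  also have "\<dots> = \<omega> ^ (l mod N)" by (simp only: power_add power_mult[of \<omega> N] root_power power_one mult_1)
  finally show ?thesis by simp
qed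

lemma root_power_eq_iff: "\<omega> ^ l = \<omega> ^ m \<longleftrightarrow> l mod N = m mod N"
proof
  have less: False if "\<omega> ^ i = \<omega> ^ j" "i < j" "j < N" for i j
  proof -
    have "\<omega> ^ j = \<omega> ^ i * \<omega> ^ (j - i)" using that(2) by (simp flip: power_add)
    then have "\<omega> ^ (j - i) = 1" using that(1) root_power(2) by simp
    then show False using primitive that by (auto simp: primitive_root_of_unity_def)
  qed
  assume "\<omega> ^ l = \<omega> ^ m"
  then have "\<omega> ^ (l mod N) = \<omega> ^ (m mod N)" by (simp only: root_power_mod)
  then show "l mod N = m mod N"
    using less[of "l mod N" "m mod N"] less[of "m mod N" "l mod N"] N_pos(2)
    by (metis linorder_neqE_nat mod_less_divisor)
qed (metis root_power_mod)

text \<open>This is how the sign in \<open>g x = - x g\<close> becomes an index shift by \<open>\<nu>\<close>.\<close>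

lemma root_half: "\<omega> ^ \<nu> = - 1"
proof -
  have "(\<omega> ^ \<nu>)\<^sup>2 = 1" using root_power(1) by (simp add: power_mult[symmetric] mult.commute)
  moreover have "\<omega> ^ \<nu> \<noteq> 1" using primitive N_pos by (simp add: primitive_root_of_unity_def)
  ultimately show ?thesis by (simp add: power2_eq_1_iff)
qed

lemma root_orthogonality:
  "(\<Sum>i<N. \<omega> ^ (i * l) * inverse \<omega> ^ (i * m)) = (if l mod N = m mod N then scalar_N else 0)"
proof -
  define z where "z = \<omega> ^ l * inverse \<omega> ^ m"
  have z: "(\<Sum>i<N. \<omega> ^ (i * l) * inverse \<omega> ^ (i * m)) = (\<Sum>i<N. z ^ i)"
    by (simp add: z_def power_mult_distrib power_mult[symmetric] mult.commute)
  have "z = 1 \<longleftrightarrow> \<omega> ^ l = \<omega> ^ m"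
    using root_power(2) by (simp add: z_def power_inverse field_simps)
  then have one: "z = 1 \<longleftrightarrow> l mod N = m mod N" by (simp only: root_power_eq_iff)
  have "z ^ N = (\<omega> ^ N) ^ l * inverse ((\<omega> ^ N) ^ m)"
    by (simp add: z_def power_mult_distrib power_mult[symmetric] mult.commute power_inverse)
  then have "z ^ N = 1" by (simp add: root_power(1))
  then have "(\<Sum>i<N. z ^ i) = 0" if "z \<noteq> 1" using that by (simp add: geometric_sum)
  then show ?thesis unfolding z using one by (auto simp: scalar_N_def)
qed

text \<open>
  The vector \<open>e\<^sub>l x\<^sup>a\<close>, where \<open>e\<^sub>l\<close> is the idempotent on which \<open>g\<close> acts as \<open>\<omega>\<^sup>l\<close>. It is defined for all
  \<open>a\<close>, with value \<open>0\<close> from \<open>x\<^sup>2\<close> on, so that exponents of \<open>x\<close> can be added freely.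
\<close>

definition eig :: "nat \<Rightarrow> nat \<Rightarrow> nat \<times> nat \<Rightarrow> 'k" where
  "eig l a = (\<lambda>p. \<Sum>i<N. inverse \<omega> ^ (i * l) / scalar_N * (if a < 2 then bvec (i, a) p else 0))"

lemma eig_zero: "2 \<le> a \<Longrightarrow> eig l a = (\<lambda>_. 0)"
  by (simp add: eig_def)

lemma eig_elems: "eig l a \<in> elems H"
  by (auto simp: eig_def elems_def bvec_def radford_hopf_sel intro!: sum.neutral)

text \<open>
  The factor comes from \<open>x\<^sup>a g\<^sup>j = (-1)\<^bsup>a j\<^esup> g\<^sup>j x\<^sup>a\<close> together with \<open>(-1)\<^bsup>a j\<^esup> = \<omega>\<^bsup>j a \<nu>\<^esup>\<close>: right
  multiplication by \<open>g\<close> has the eigenvalue \<open>\<omega>\<^bsup>l + a \<nu>\<^esup>\<close> on \<open>e\<^sub>l x\<^sup>a\<close>.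
\<close>

lemma eig_mult_bvec:
  assumes j: "j < N" and b: "b < 2"
  shows "amult H (eig l a) (bvec (j, b)) = (\<lambda>p. \<omega> ^ (j * (l + a * \<nu>)) * eig l (a + b) p)"
proof (cases "a < 2")
  case False
  then show ?thesis by (simp add: eig_zero amult_linear)
next
  case True
  show ?thesis
  proof
    fix p :: "nat \<times> nat"
    let ?B = "\<lambda>i. if a + b < 2 then bvec (i, a + b) p else (0 :: 'k)"
    have sign: "\<omega> ^ (j * (a * \<nu>)) = (- 1) ^ (a * j)"
      by (simp add: root_half[symmetric] power_mult[symmetric] mult_ac)
    have shift: "inverse \<omega> ^ (i * l) = \<omega> ^ (j * l) * inverse \<omega> ^ ((i + j) mod N * l)" for i
    proof -
      have "\<omega> ^ ((i + j) mod N * l) = \<omega> ^ (i * l) * \<omega> ^ (j * l)"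
        by (simp add: power_mult root_power_mod power_add power_mult_distrib)
      then show ?thesis using root_power(2) by (simp add: power_inverse field_simps)
    qed
    (* The product with bvec (j, b) translates the exponent of g by j modulo N. *)
    have bij: "bij_betw (\<lambda>i. (i + j) mod N) {..<N} {..<N}"
    proof (rule bij_betw_byWitness[where f' = "\<lambda>i. (i + (N - j)) mod N"])
      have "i + j + (N - j) = i + N" "i + (N - j) + j = i + N" for i using j by simp_all
      then show "\<forall>i\<in>{..<N}. ((i + j) mod N + (N - j)) mod N = i"
        "\<forall>i\<in>{..<N}. ((i + (N - j)) mod N + j) mod N = i"
        by (simp_all only: mod_simps) simp_all
    qed (use N_pos in auto)
    have "amult H (eig l a) (bvec (j, b)) p =
        (\<Sum>i<N. inverse \<omega> ^ (i * l) / scalar_N * ((- 1) ^ (a * j) * ?B ((i + j) mod N)))"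
      using True j b
      by (simp add: eig_def amult_sum_left radford_hopf_amult radford_mult if_distrib[of "\<lambda>u. u p"]
          if_distrib[of "\<lambda>y. (- 1) ^ (a * j) * y"] cong: if_cong del: times_divide_eq_left times_divide_eq_right)
    also have "\<dots> = \<omega> ^ (j * l) * (- 1) ^ (a * j) *
        (\<Sum>i<N. inverse \<omega> ^ ((i + j) mod N * l) / scalar_N * ?B ((i + j) mod N))"
      unfolding sum_distrib_left by (rule sum.cong[OF refl], subst shift) (simp add: mult_ac)
    also have "(\<Sum>i<N. inverse \<omega> ^ ((i + j) mod N * l) / scalar_N * ?B ((i + j) mod N)) = eig l (a + b) p"
      unfolding eig_def
      by (rule sum.reindex_bij_betw[OF bij, of "\<lambda>i. inverse \<omega> ^ (i * l) / scalar_N * ?B i"])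
    finally show "amult H (eig l a) (bvec (j, b)) p = \<omega> ^ (j * (l + a * \<nu>)) * eig l (a + b) p"
      by (simp add: distrib_left power_add sign)
  qed
qed

text \<open>
  Expanding \<open>e\<^sub>m\<close> in powers of \<open>g\<close> averages the eigenvalue \<open>\<omega>\<^bsup>l + a \<nu>\<^esup>\<close> against the character of
  index \<open>m\<close>, and orthogonality leaves one index.
\<close>

lemma eig_mult:
  assumes m: "m < N"
  shows "amult H (eig l a) (eig m b) = (if m = (l + a * \<nu>) mod N then eig l (a + b) else (\<lambda>_. 0))"
proof (cases "b < 2")
  case False
  then show ?thesis by (simp add: eig_zero amult_linear)
next
  case True
  show ?thesis
  proof
    fix p
    have "amult H (eig l a) (eig m b) p =
        (\<Sum>j<N. inverse \<omega> ^ (j * m) / scalar_N * (\<omega> ^ (j * (l + a * \<nu>)) * eig l (a + b) p))"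
      using True by (subst eig_def[of m b]) (simp add: amult_sum_right eig_mult_bvec del: times_divide_eq_left times_divide_eq_right)
    also have "\<dots> = (\<Sum>j<N. \<omega> ^ (j * (l + a * \<nu>)) * inverse \<omega> ^ (j * m)) / scalar_N * eig l (a + b) p"
      unfolding sum_divide_distrib sum_distrib_right by (rule sum.cong) (simp_all add: mult_ac)
    finally show "amult H (eig l a) (eig m b) p =
        (if m = (l + a * \<nu>) mod N then eig l (a + b) else (\<lambda>_. 0)) p"
      unfolding root_orthogonality using m scalar_N_nonzero by auto
  qed
qed

lemma unit_eig: "unit H = (\<lambda>p. \<Sum>l<N. eig l 0 p)"
proof
  fix p :: "nat \<times> nat"
  have "(\<Sum>l<N. eig l 0 p) = (\<Sum>i<N. \<Sum>l<N. inverse \<omega> ^ (i * l) / scalar_N * bvec (i, 0) p)"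
    unfolding eig_def by (subst sum.swap) simp
  also have "\<dots> = (\<Sum>i<N. (\<Sum>l<N. \<omega> ^ (l * 0) * inverse \<omega> ^ (l * i)) / scalar_N * bvec (i, 0) p)"
    by (simp add: divide_inverse sum_distrib_right mult.commute[of _ "_::nat"])
  also have "\<dots> = (\<Sum>i<N. if i = 0 then bvec (0, 0) p else 0)"
    unfolding root_orthogonality using scalar_N_nonzero by (intro sum.cong) auto
  also have "\<dots> = unit H p" using N_pos by (simp add: radford_hopf_sel)
  finally show "unit H p = (\<Sum>l<N. eig l 0 p)" by simp
qed

lemma assoc_algebra_H: "assoc_algebra H"
proof -
  have "hopf_algebra H" by (rule radford_hopf_algebra[OF odd_nu])
  then show ?thesis by (simp add: hopf_algebra_def)
qed

lemma apow_H: "apow H u n = apow (radford_alg \<nu>) u n"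
  by (induction n) (simp_all add: radford_hopf_sel radford_unit radford_hopf_amult)

lemma bvec_eig:
  assumes "j < N" "b < 2"
  shows "bvec (j, b) = (\<lambda>p. \<Sum>l<N. \<omega> ^ (j * l) * eig l b p)"
proof -
  have "bvec (j, b) = amult H (unit H) (bvec (j, b))"
    using assms assoc_algebra_H by (simp add: assoc_algebra_def bvec_elems radford_hopf_sel)
  also have "\<dots> = (\<lambda>p. \<Sum>l<N. \<omega> ^ (j * l) * eig l b p)"
    unfolding unit_eig using amult_sum_left[of "{..<N}" H "\<lambda>_. 1" "\<lambda>l. eig l 0"] assms
    by (simp add: eig_mult_bvec)
  finally show ?thesis .
qed

section \<open>Coefficient calculus in tensor powers\<close>

definition eig2 :: "(nat \<Rightarrow> nat \<Rightarrow> 'k) \<Rightarrow> nat \<Rightarrow> nat \<Rightarrow> (nat \<times> nat) \<times> (nat \<times> nat) \<Rightarrow> 'k" where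
  "eig2 c a b = (\<lambda>p. \<Sum>(l, m)\<in>{..<N} \<times> {..<N}. c l m * (eig l a \<otimes>\<^sub>v eig m b) p)"

definition eig3 :: "(nat \<Rightarrow> nat \<Rightarrow> nat \<Rightarrow> 'k) \<Rightarrow> nat \<Rightarrow> nat \<Rightarrow> nat \<Rightarrow>
    (nat \<times> nat) \<times> (nat \<times> nat) \<times> (nat \<times> nat) \<Rightarrow> 'k" where
  "eig3 c a b d = (\<lambda>p. \<Sum>(l, m, n)\<in>{..<N} \<times> {..<N} \<times> {..<N}.
     c l m n * (eig l a \<otimes>\<^sub>v eig m b \<otimes>\<^sub>v eig n d) p)"

lemma eig2_mult:
  "amult (H \<otimes>\<^sub>a H) (eig2 c a b) (eig2 c' a' b') =
    eig2 (\<lambda>l m. c l m * c' ((l + a * \<nu>) mod N) ((m + b * \<nu>) mod N)) (a + a') (b + b')"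
  unfolding eig2_def split_beta
  using N_pos
  by (subst amult_matched_sums[where \<sigma> = "\<lambda>i. ((fst i + a * \<nu>) mod N, (snd i + b * \<nu>) mod N)"
      and h = "\<lambda>i. eig (fst i) (a + a') \<otimes>\<^sub>v eig (snd i) (b + b')"])
    (auto simp: amult_tensor eig_mult tensor_vec_linear)

lemma eig3_mult:
  "amult (H \<otimes>\<^sub>a H \<otimes>\<^sub>a H) (eig3 c a b d) (eig3 c' a' b' d') =
    eig3 (\<lambda>l m n. c l m n * c' ((l + a * \<nu>) mod N) ((m + b * \<nu>) mod N) ((n + d * \<nu>) mod N))
      (a + a') (b + b') (d + d')"
  unfolding eig3_def split_beta
  using N_pos
  by (subst amult_matched_sums[where \<sigma> = "\<lambda>i. ((fst i + a * \<nu>) mod N,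
        (fst (snd i) + b * \<nu>) mod N, (snd (snd i) + d * \<nu>) mod N)"
      and h = "\<lambda>i. eig (fst i) (a + a') \<otimes>\<^sub>v eig (fst (snd i)) (b + b') \<otimes>\<^sub>v eig (snd (snd i)) (d + d')"])
    (auto simp: amult_tensor eig_mult tensor_vec_linear)

lemma eig2_zero: "2 \<le> a \<or> 2 \<le> b \<Longrightarrow> eig2 c a b = (\<lambda>_. 0)"
  by (auto simp: eig2_def eig_zero tensor_vec_linear)

lemma eig3_zero: "2 \<le> a \<or> 2 \<le> b \<or> 2 \<le> d \<Longrightarrow> eig3 c a b d = (\<lambda>_. 0)"
  by (auto simp: eig3_def eig_zero tensor_vec_linear)

lemma eig2_elems: "eig2 c a b \<in> elems (H \<otimes>\<^sub>a H)"
proof -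
  have "eig l a p = 0" if "p \<notin> basis H" for l a p using eig_elems elemsD[OF _ that] by blast
  then show ?thesis by (auto simp: eig2_def elems_def tensor_vec_def tensor_alg_def intro!: sum.neutral)
qed

lemma unit_eig2: "unit (H \<otimes>\<^sub>a H) = eig2 (\<lambda>_ _. 1) 0 0"
  by (auto simp: tensor_unit unit_eig eig2_def tensor_vec_def sum_product sum.cartesian_product fun_eq_iff)


lemma eig2_sum: "(\<lambda>p. \<Sum>j\<in>J. f j * eig2 (c j) a b p) = eig2 (\<lambda>l m. \<Sum>j\<in>J. f j * c j l m) a b"
  unfolding eig2_def split_beta sum_distrib_left sum_distrib_right
  by (subst sum.swap) (simp add: mult.assoc)

lemma eig2_apply: "eig2 c a b (x, y) = (\<Sum>l<N. \<Sum>m<N. c l m * (eig l a x * eig m b y))"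
  by (simp add: eig2_def tensor_vec_def sum.cartesian_product)

lemma eig3_apply:
  "eig3 c a b d (x, y, z) = (\<Sum>l<N. \<Sum>m<N. \<Sum>n<N. c l m n * (eig l a x * eig m b y * eig n d z))"
  by (simp add: eig3_def tensor_vec_def sum.cartesian_product split_beta mult.assoc)

section \<open>Coproduct and placements in the eigenbasis\<close>

lemma bvec_tensor_eig:
  assumes "i < N" "j < N" "a < 2" "b < 2"
  shows "bvec (i, a) \<otimes>\<^sub>v bvec (j, b) = eig2 (\<lambda>l m. \<omega> ^ (i * l) * \<omega> ^ (j * m)) a b"
  using assms
  by (auto simp: fun_eq_iff eig2_apply tensor_vec_def bvec_eig sum_product mult_ac intro!: sum.cong)

lemma root_power_shift: "\<omega> ^ ((j + \<nu>) mod N * q) = \<omega> ^ (j * q) * (- 1) ^ q"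
  by (simp only: power_mult root_power_mod power_add root_half power_mult_distrib)

lemma orthogonality_delta:
  assumes "l < N"
  shows "(\<Sum>j<N. inverse \<omega> ^ (j * l) / scalar_N * (\<omega> ^ (j * p) * \<omega> ^ (j * q))) = of_bool ((p + q) mod N = l)"
proof -
  have "(\<Sum>j<N. inverse \<omega> ^ (j * l) / scalar_N * (\<omega> ^ (j * p) * \<omega> ^ (j * q))) =
      (\<Sum>j<N. \<omega> ^ (j * (p + q)) * inverse \<omega> ^ (j * l)) / scalar_N"
    by (simp add: sum_divide_distrib distrib_left power_add mult_ac)
  then show ?thesis unfolding root_orthogonality using assms scalar_N_nonzero by simp
qed

text \<open>
  As \<open>g\<close> is grouplike, \<open>\<Delta>(g\<^sup>j)\<close> acts on \<open>e\<^sub>p \<otimes> e\<^sub>q\<close> as \<open>\<omega>\<^bsup>j (p + q)\<^esup>\<close>, and orthogonality turns the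
  average over \<open>j\<close> that defines \<open>e\<^sub>l\<close> into the condition \<open>p + q \<equiv> l\<close>.
\<close>

lemma comult_eig_0:
  assumes "l < N"
  shows "comult H (eig l 0) = eig2 (\<lambda>p q. of_bool ((p + q) mod N = l)) 0 0"
proof -
  have "comult H (eig l 0) =
      (\<lambda>x. \<Sum>j<N. inverse \<omega> ^ (j * l) / scalar_N * (bvec (j, 0) \<otimes>\<^sub>v bvec (j, 0)) x)"
    using N_pos unfolding eig_def
    by (simp add: comult_sum radford_comult del: times_divide_eq_left times_divide_eq_right)
  also have "\<dots> = (\<lambda>x. \<Sum>j<N. inverse \<omega> ^ (j * l) / scalar_N *
      eig2 (\<lambda>p q. \<omega> ^ (j * p) * \<omega> ^ (j * q)) 0 0 x)"
    by (auto simp: bvec_tensor_eig fun_eq_iff intro!: sum.cong)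
  finally show ?thesis unfolding eig2_sum orthogonality_delta[OF assms] .
qed

text \<open>The sign is the factor \<open>g\<^sup>\<nu>\<close> of \<open>\<Delta>(x) = x \<otimes> g\<^sup>\<nu> + 1 \<otimes> x\<close>, which acts on \<open>e\<^sub>q\<close> as \<open>(-1)\<^sup>q\<close>.\<close>

lemma comult_eig_1:
  assumes "l < N"
  shows "comult H (eig l 1) = (\<lambda>x. eig2 (\<lambda>p q. of_bool ((p + q) mod N = l) * (- 1) ^ q) 1 0 x +
    eig2 (\<lambda>p q. of_bool ((p + q) mod N = l)) 0 1 x)"
proof -
  have "comult H (eig l 1) =
      (\<lambda>x. (\<Sum>j<N. inverse \<omega> ^ (j * l) / scalar_N * (bvec (j, 1) \<otimes>\<^sub>v bvec ((j + \<nu>) mod N, 0)) x) +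
        (\<Sum>j<N. inverse \<omega> ^ (j * l) / scalar_N * (bvec (j, 0) \<otimes>\<^sub>v bvec (j, 1)) x))"
    using N_pos unfolding eig_def
    by (simp add: comult_sum radford_comult distrib_left sum.distrib
        del: times_divide_eq_left times_divide_eq_right)
  also have "\<dots> = (\<lambda>x. (\<Sum>j<N. inverse \<omega> ^ (j * l) / scalar_N *
        eig2 (\<lambda>p q. \<omega> ^ (j * p) * (\<omega> ^ (j * q) * (- 1) ^ q)) 1 0 x) +
      (\<Sum>j<N. inverse \<omega> ^ (j * l) / scalar_N * eig2 (\<lambda>p q. \<omega> ^ (j * p) * \<omega> ^ (j * q)) 0 1 x))"
    using N_pos by (simp add: bvec_tensor_eig root_power_shift del: One_nat_def cong: sum.cong_simp)
  also have "\<dots> = (\<lambda>x. eig2 (\<lambda>p q. (\<Sum>j<N. inverse \<omega> ^ (j * l) / scalar_N * (\<omega> ^ (j * p) * \<omega> ^ (j * q)))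
        * (- 1) ^ q) 1 0 x +
      eig2 (\<lambda>p q. \<Sum>j<N. inverse \<omega> ^ (j * l) / scalar_N * (\<omega> ^ (j * p) * \<omega> ^ (j * q))) 0 1 x)"
    unfolding eig2_sum[THEN fun_cong] sum_distrib_right by (simp only: mult.assoc)
  finally show ?thesis unfolding orthogonality_delta[OF assms] .
qed

lemma sum_swap4:
  "(\<Sum>l\<in>A. \<Sum>m\<in>B. \<Sum>p\<in>C. \<Sum>q\<in>D. f l m p q) = (\<Sum>p\<in>C. \<Sum>q\<in>D. \<Sum>m\<in>B. \<Sum>l\<in>A. f l m p q)"
  unfolding sum.cartesian_product
  by (rule sum.reindex_bij_witness[of _ "\<lambda>(p, q, m, l). (l, m, p, q)" "\<lambda>(l, m, p, q). (p, q, m, l)"]) auto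

text \<open>
  Applying the coproduct to one tensor factor substitutes \<open>p + q\<close> for the corresponding index of the
  coefficient function; \<open>f\<close> accommodates the sign in the coproduct of \<open>e\<^sub>l x\<close>.
\<close>

lemma comult_fst_delta:
  "(\<Sum>l<N. \<Sum>m<N. c l m * (eig2 (\<lambda>p q. of_bool ((p + q) mod N = l) * f p q) a a' (x, y) * eig m b z)) =
    eig3 (\<lambda>p q m. c ((p + q) mod N) m * f p q) a a' b (x, y, z)"
proof -
  have "(\<Sum>l<N. \<Sum>m<N. c l m * (eig2 (\<lambda>p q. of_bool ((p + q) mod N = l) * f p q) a a' (x, y) * eig m b z)) =
    (\<Sum>l<N. \<Sum>m<N. \<Sum>p<N. \<Sum>q<N. if l = (p + q) mod N
      then c ((p + q) mod N) m * f p q * (eig p a x * eig q a' y * eig m b z) else 0)"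
    unfolding eig2_apply sum_distrib_left sum_distrib_right by (intro sum.cong refl) auto
  also have "\<dots> = (\<Sum>p<N. \<Sum>q<N. \<Sum>m<N. \<Sum>l<N. if l = (p + q) mod N
      then c ((p + q) mod N) m * f p q * (eig p a x * eig q a' y * eig m b z) else 0)"
    by (rule sum_swap4)
  also have "\<dots> = eig3 (\<lambda>p q m. c ((p + q) mod N) m * f p q) a a' b (x, y, z)"
    using N_pos by (simp add: eig3_apply)
  finally show ?thesis .
qed

lemma sum_rotate4:
  "(\<Sum>l\<in>A. \<Sum>m\<in>B. \<Sum>p\<in>C. \<Sum>q\<in>D. f l m p q) = (\<Sum>l\<in>A. \<Sum>p\<in>C. \<Sum>q\<in>D. \<Sum>m\<in>B. f l m p q)"
  unfolding sum.cartesian_product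
  by (rule sum.reindex_bij_witness[of _ "\<lambda>(l, p, q, m). (l, m, p, q)" "\<lambda>(l, m, p, q). (l, p, q, m)"]) auto

lemma comult_snd_delta:
  "(\<Sum>l<N. \<Sum>m<N. c l m * (eig l a x * eig2 (\<lambda>p q. of_bool ((p + q) mod N = m) * f p q) b b' (y, z))) =
    eig3 (\<lambda>l p q. c l ((p + q) mod N) * f p q) a b b' (x, y, z)"
proof -
  have "(\<Sum>l<N. \<Sum>m<N. c l m * (eig l a x * eig2 (\<lambda>p q. of_bool ((p + q) mod N = m) * f p q) b b' (y, z))) =
    (\<Sum>l<N. \<Sum>m<N. \<Sum>p<N. \<Sum>q<N. if m = (p + q) mod N
      then c l ((p + q) mod N) * f p q * (eig l a x * eig p b y * eig q b' z) else 0)"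
    unfolding eig2_apply sum_distrib_left sum_distrib_right by (intro sum.cong refl) auto
  also have "\<dots> = (\<Sum>l<N. \<Sum>p<N. \<Sum>q<N. \<Sum>m<N. if m = (p + q) mod N
      then c l ((p + q) mod N) * f p q * (eig l a x * eig p b y * eig q b' z) else 0)"
    by (rule sum_rotate4)
  also have "\<dots> = eig3 (\<lambda>l p q. c l ((p + q) mod N) * f p q) a b b' (x, y, z)"
    using N_pos by (simp add: eig3_apply)
  finally show ?thesis .
qed

lemma comult_fst_eig2:
  "comult_fst H (eig2 c a b) (x, y, z) = (\<Sum>l<N. \<Sum>m<N. c l m * (comult H (eig l a) (x, y) * eig m b z))"
  unfolding eig2_def split_beta
  by (simp add: comult_fst_sum comult_fst_linear(3)) (simp add: tensor_vec_def sum.cartesian_product split_beta)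

lemma comult_snd_eig2:
  "comult_snd H (eig2 c a b) (x, y, z) = (\<Sum>l<N. \<Sum>m<N. c l m * (eig l a x * comult H (eig m b) (y, z)))"
  unfolding eig2_def split_beta
  by (simp add: comult_snd_sum comult_snd_linear(3)) (simp add: tensor_vec_def sum.cartesian_product split_beta)

lemma comult_fst_eig2_0:
  "comult_fst H (eig2 c 0 b) = eig3 (\<lambda>p q m. c ((p + q) mod N) m) 0 0 b"
proof -
  have "comult_fst H (eig2 c 0 b) (x, y, z) = eig3 (\<lambda>p q m. c ((p + q) mod N) m) 0 0 b (x, y, z)" for x y z
    using comult_fst_delta[of c "\<lambda>_ _. 1" 0 0 x y b z]
    by (simp add: comult_fst_eig2 comult_eig_0 cong: sum.cong_simp)
  then show ?thesis by auto
qed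

lemma comult_fst_eig2_1:
  "comult_fst H (eig2 c 1 b) = (\<lambda>x. eig3 (\<lambda>p q m. c ((p + q) mod N) m * (- 1) ^ q) 1 0 b x +
    eig3 (\<lambda>p q m. c ((p + q) mod N) m) 0 1 b x)"
proof -
  have "comult_fst H (eig2 c 1 b) (x, y, z) =
      eig3 (\<lambda>p q m. c ((p + q) mod N) m * (- 1) ^ q) 1 0 b (x, y, z) +
      eig3 (\<lambda>p q m. c ((p + q) mod N) m) 0 1 b (x, y, z)" for x y z
    using comult_fst_delta[of c "\<lambda>_ q. (- 1) ^ q" 1 0 x y b z] comult_fst_delta[of c "\<lambda>_ _. 1" 0 1 x y b z]
    by (simp add: comult_fst_eig2 comult_eig_1 distrib_left distrib_right sum.distrib
        del: One_nat_def cong: sum.cong_simp)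
  then show ?thesis by auto
qed

lemma comult_snd_eig2_0:
  "comult_snd H (eig2 c a 0) = eig3 (\<lambda>l p q. c l ((p + q) mod N)) a 0 0"
proof -
  have "comult_snd H (eig2 c a 0) (x, y, z) = eig3 (\<lambda>l p q. c l ((p + q) mod N)) a 0 0 (x, y, z)" for x y z
    using comult_snd_delta[of c a x "\<lambda>_ _. 1" 0 0 y z]
    by (simp add: comult_snd_eig2 comult_eig_0 cong: sum.cong_simp)
  then show ?thesis by auto
qed

lemma comult_snd_eig2_1:
  "comult_snd H (eig2 c a 1) = (\<lambda>x. eig3 (\<lambda>l p q. c l ((p + q) mod N) * (- 1) ^ q) a 1 0 x +
    eig3 (\<lambda>l p q. c l ((p + q) mod N)) a 0 1 x)"
proof -
  have "comult_snd H (eig2 c a 1) (x, y, z) =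
      eig3 (\<lambda>l p q. c l ((p + q) mod N) * (- 1) ^ q) a 1 0 (x, y, z) +
      eig3 (\<lambda>l p q. c l ((p + q) mod N)) a 0 1 (x, y, z)" for x y z
    using comult_snd_delta[of c a x "\<lambda>_ q. (- 1) ^ q" 1 0 y z] comult_snd_delta[of c a x "\<lambda>_ _. 1" 0 1 y z]
    by (simp add: comult_snd_eig2 comult_eig_1 distrib_left distrib_right sum.distrib
        del: One_nat_def cong: sum.cong_simp)
  then show ?thesis by auto
qed

lemma place_eig2:
  "place12 H (eig2 c a b) = eig3 (\<lambda>l m n. c l m) a b 0"
  "place13 H (eig2 c a b) = eig3 (\<lambda>l m n. c l n) a 0 b"
  "place23 H (eig2 c a b) = eig3 (\<lambda>l m n. c m n) 0 a b"
  "place31 H (eig2 c a b) = eig3 (\<lambda>l m n. c n l) b 0 a"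
proof -
  have prod: "(\<Sum>l<N. \<Sum>m<N. f l m) * (\<Sum>n<N. h n) = (\<Sum>l<N. \<Sum>m<N. \<Sum>n<N. f l m * h n)"
    for f and h :: "nat \<Rightarrow> 'k"
    unfolding sum_distrib_right by (simp add: sum_distrib_left)
  have prod': "(\<Sum>n<N. h n) * (\<Sum>l<N. \<Sum>m<N. f l m) = (\<Sum>n<N. \<Sum>l<N. \<Sum>m<N. h n * f l m)"
    for f and h :: "nat \<Rightarrow> 'k"
    unfolding sum_distrib_right by (simp add: sum_distrib_left)
  have rot: "(\<Sum>l<N. \<Sum>m<N. \<Sum>n<N. f l m n) = (\<Sum>m<N. \<Sum>n<N. \<Sum>l<N. f l m n)"
    for f :: "nat \<Rightarrow> nat \<Rightarrow> nat \<Rightarrow> 'k"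
    unfolding sum.cartesian_product
    by (rule sum.reindex_bij_witness[of _ "\<lambda>(m, n, l). (l, m, n)" "\<lambda>(l, m, n). (m, n, l)"]) auto
  show "place12 H (eig2 c a b) = eig3 (\<lambda>l m n. c l m) a b 0"
    by (auto simp: place12_def eig2_apply eig3_apply unit_eig prod mult.assoc)
  show "place23 H (eig2 c a b) = eig3 (\<lambda>l m n. c m n) 0 a b"
    by (auto simp: place23_def eig2_apply eig3_apply unit_eig prod' mult.assoc mult.left_commute)
  have "(\<Sum>l<N. \<Sum>m<N. \<Sum>n<N. c l m * (eig l a x * eig m b z) * eig n 0 y) =
      (\<Sum>l<N. \<Sum>m<N. \<Sum>n<N. c l n * (eig l a x * eig m 0 y * eig n b z))" for x y z
    by (rule sum.cong[OF refl], subst sum.swap) (simp add: mult_ac)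
  then show "place13 H (eig2 c a b) = eig3 (\<lambda>l m n. c l n) a 0 b"
    by (auto simp: place13_def eig2_apply eig3_apply unit_eig prod)
  have "(\<Sum>l<N. \<Sum>m<N. \<Sum>n<N. c l m * (eig l a z * eig m b x) * eig n 0 y) =
      (\<Sum>l<N. \<Sum>m<N. \<Sum>n<N. c n l * (eig l b x * eig m 0 y * eig n a z))" for x y z
    by (subst rot) (simp add: mult_ac)
  then show "place31 H (eig2 c a b) = eig3 (\<lambda>l m n. c n l) b 0 a"
    by (auto simp: place31_def eig2_apply eig3_apply unit_eig prod)
qed

lemma place_add:
  "place12 H (\<lambda>p. Q p + Q' p) = (\<lambda>p. place12 H Q p + place12 H Q' p)"
  "place13 H (\<lambda>p. Q p + Q' p) = (\<lambda>p. place13 H Q p + place13 H Q' p)"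
  "place23 H (\<lambda>p. Q p + Q' p) = (\<lambda>p. place23 H Q p + place23 H Q' p)"
  "place31 H (\<lambda>p. Q p + Q' p) = (\<lambda>p. place31 H Q p + place31 H Q' p)"
  by (auto simp: place12_def place13_def place23_def place31_def algebra_simps)

end

section \<open>Radford's matrices\<close>

locale radford_matrix = radford_root \<nu> \<omega> for \<nu> :: nat and \<omega> :: "'k::field" +
  fixes s :: nat and \<beta> :: 'k
  assumes odd_s: "odd s"
begin

definition \<chi> :: "nat \<Rightarrow> nat \<Rightarrow> 'k" where
  "\<chi> l m = \<omega> ^ (s * l * m)"

definition \<psi> :: "nat \<Rightarrow> nat \<Rightarrow> 'k" where
  "\<psi> l m = inverse (\<chi> l m)"

lemma chi_mod: "\<chi> (l mod N) m = \<chi> l m" "\<chi> l (m mod N) = \<chi> l m"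
proof -
  show "\<chi> (l mod N) m = \<chi> l m"
    using arg_cong[of _ _ "\<lambda>z. z ^ (s * m)", OF root_power_mod[of l]]
    by (simp add: \<chi>_def mult_ac flip: power_mult)
  show "\<chi> l (m mod N) = \<chi> l m"
    using arg_cong[of _ _ "\<lambda>z. z ^ (s * l)", OF root_power_mod[of m]]
    by (simp add: \<chi>_def mult_ac flip: power_mult)
qed

lemma chi_add: "\<chi> (l + l') m = \<chi> l m * \<chi> l' m" "\<chi> l (m + m') = \<chi> l m * \<chi> l m'"
  by (simp_all add: \<chi>_def algebra_simps power_add)

text \<open>For odd \<open>s\<close>, shifting an argument of \<open>\<chi>\<close> by \<open>\<nu>\<close> produces a sign that does not depend on \<open>s\<close>.\<close>

lemma chi_nu: "\<chi> \<nu> m = (- 1) ^ m" "\<chi> l \<nu> = (- 1) ^ l"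
proof -
  have "\<omega> ^ (\<nu> * (s * k)) = (- 1) ^ k" for k
    using odd_s by (simp add: power_mult root_half)
  from this[of m] this[of l] show "\<chi> \<nu> m = (- 1) ^ m" "\<chi> l \<nu> = (- 1) ^ l"
    by (simp_all add: \<chi>_def mult_ac)
qed

lemma chi_nonzero: "\<chi> l m \<noteq> 0"
  using root_power(2) by (simp add: \<chi>_def)

lemma sign_inverse: "inverse ((- 1 :: 'k) ^ l) = (- 1) ^ l"
  by (cases "even l") simp_all

lemma psi_rules:
  "\<psi> (l mod N) m = \<psi> l m" "\<psi> l (m mod N) = \<psi> l m"
  "\<psi> (l + l') m = \<psi> l m * \<psi> l' m" "\<psi> l (m + m') = \<psi> l m * \<psi> l m'"
  "\<psi> \<nu> m = (- 1) ^ m" "\<psi> l \<nu> = (- 1) ^ l"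
  by (simp_all add: \<psi>_def chi_mod chi_add chi_nu sign_inverse)

lemma chi_psi: "\<chi> l m * \<psi> l m = 1" "\<psi> l m * \<chi> l m = 1"
  using chi_nonzero by (simp_all add: \<psi>_def)

lemma sign_cancel: "(- 1) ^ l * ((- 1) ^ l * y) = (y :: 'k)" "(- 1) ^ l * (- 1) ^ l = (1 :: 'k)"
  by (cases "even l"; simp)+

lemma sign_rules: "(- 1 :: 'k) ^ (l mod N) = (- 1) ^ l" "(- 1 :: 'k) ^ (l + \<nu>) = - ((- 1) ^ l)"
  "(- 1 :: 'k) ^ \<nu> = - 1"
  using odd_nu by (simp_all add: neg_one_power_mod power_add)

text \<open>
  Rewriting to a normal form for coefficient functions: index shifts become signs, reductions
  modulo \<open>N\<close> disappear, equal signs cancel and the remaining factors in \<open>k\<close> are sorted.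
\<close>

lemmas phase_rules = chi_mod chi_add chi_nu psi_rules sign_cancel sign_rules power_add
  mult.commute[of _ "_ :: 'k"] mult.left_commute[of _ "_ :: 'k"] mult.assoc[of _ _ "_ :: 'k"]

abbreviation R where "R \<equiv> radford_R \<nu> \<omega> s \<beta>"

text \<open>
  Summing over \<open>i\<close> gives \<open>R = \<Sum>\<^sub>l e\<^sub>l \<otimes> g\<^bsup>s l\<^esup> + \<beta> \<Sum>\<^sub>l e\<^sub>l x \<otimes> g\<^bsup>s l + \<nu>\<^esup> x\<close>; it remains to write the
  powers of \<open>g\<close> in the second factor by their eigenvalues.
\<close>

lemma R_eig: "R = (\<lambda>p. eig2 \<chi> 0 0 p + eig2 (\<lambda>l m. \<beta> * (\<chi> l m * (- 1) ^ m)) 1 1 p)"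
proof (rule ext, clarify)
  fix x1 x2 y1 y2
  let ?x = "(x1, x2) :: nat \<times> nat" and ?y = "(y1, y2) :: nat \<times> nat"
  have ivl: "{0..N - 1} = {..<N}" using N_pos by auto
  have pow: "apow H rad_g n = bvec (n mod N, 0)" for n
    using radford_apow_g[OF N_pos(1), of n] by (simp add: apow_H)
  have gx: "amult H (bvec (n mod N, 0)) rad_x = bvec (n mod N, 1)" for n
    using N_pos by (simp add: radford_hopf_amult rad_x_def radford_mult)
  have first: "(\<Sum>i<N. \<Sum>l<N. inverse \<omega> ^ (i * l) * (bvec (i mod N, a) ?x * v l)) / scalar_N =
      (\<Sum>l<N. eig l a ?x * v l)" if "a < 2" for a and v :: "nat \<Rightarrow> 'k"
    unfolding sum_divide_distrib using that
    by (subst sum.swap) (simp add: eig_def sum_distrib_left sum_distrib_right mult_ac)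
  have second: "bvec (n mod N, b) ?y = (\<Sum>m<N. \<omega> ^ (n * m) * eig m b ?y)" if "b < 2" for n b
    using that N_pos by (simp add: bvec_eig power_mult root_power_mod)
  have phase: "\<omega> ^ ((s * l + \<nu>) * m) = \<chi> l m * (- 1) ^ m" for l m
    by (simp add: \<chi>_def distrib_right power_add power_mult[of \<omega> \<nu>] root_half)
  have lt: "(0 :: nat) < 2" "(1 :: nat) < 2" by simp_all
  have "R (?x, ?y) =
      (\<Sum>i<N. \<Sum>l<N. inverse \<omega> ^ (i * l) * (bvec (i mod N, 0) ?x * bvec ((s * l) mod N, 0) ?y)) / scalar_N +
      \<beta> * ((\<Sum>i<N. \<Sum>l<N. inverse \<omega> ^ (i * l) *
        (bvec (i mod N, 1) ?x * bvec ((s * l + \<nu>) mod N, 1) ?y)) / scalar_N)"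
    unfolding radford_R_def Let_def ivl pow gx by (simp add: tensor_vec_def scalar_N_def)
  also have "\<dots> = (\<Sum>l<N. eig l 0 ?x * (\<Sum>m<N. \<omega> ^ (s * l * m) * eig m 0 ?y)) +
      \<beta> * (\<Sum>l<N. eig l 1 ?x * (\<Sum>m<N. \<omega> ^ ((s * l + \<nu>) * m) * eig m 1 ?y))"
    by (simp only: first[OF lt(1)] first[OF lt(2)] second[OF lt(1)] second[OF lt(2)])
  also have "\<dots> = eig2 \<chi> 0 0 (?x, ?y) + eig2 (\<lambda>l m. \<beta> * (\<chi> l m * (- 1) ^ m)) 1 1 (?x, ?y)"
    unfolding eig2_apply sum_distrib_left phase \<chi>_def[symmetric] by (simp add: mult_ac)
  finally show "R (?x, ?y) = \<dots>" .
qed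

text \<open>
  With \<open>R\<^sub>0\<close> the part of \<open>R\<close> free of \<open>\<beta>\<close> one has \<open>R = R\<^sub>0 (1 + \<beta> x \<otimes> g\<^sup>\<nu> x)\<close> and
  \<open>(x \<otimes> g\<^sup>\<nu> x)\<^sup>2 = 0\<close>. The formula below is \<open>(1 - \<beta> x \<otimes> g\<^sup>\<nu> x) R\<^sub>0\<^sup>-\<^sup>1\<close>: moving \<open>x \<otimes> x\<close> past
  \<open>R\<^sub>0\<^sup>-\<^sup>1\<close> contributes \<open>(-1)\<^bsup>l + m + 1\<^esup>\<close>, which together with the sign \<open>- (-1)\<^sup>m\<close> already present
  leaves \<open>(-1)\<^sup>l\<close>.
\<close>

definition R_inv :: "(nat \<times> nat) \<times> (nat \<times> nat) \<Rightarrow> 'k" where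
  "R_inv = (\<lambda>p. eig2 \<psi> 0 0 p + eig2 (\<lambda>l m. \<beta> * (\<psi> l m * (- 1) ^ l)) 1 1 p)"

lemma eig2_minus: "eig2 (\<lambda>l m. - c l m) a b = (\<lambda>p. - eig2 c a b p)"
  by (simp add: eig2_def split_beta sum_negf)

lemma R_is_inverse: "is_inverse (H \<otimes>\<^sub>a H) R R_inv"
proof -
  have "R \<in> elems (H \<otimes>\<^sub>a H)" "R_inv \<in> elems (H \<otimes>\<^sub>a H)"
    by (simp_all add: R_eig R_inv_def eig2_elems[THEN elemsD] elems_def)
  moreover have "amult (H \<otimes>\<^sub>a H) R R_inv = unit (H \<otimes>\<^sub>a H)"
    unfolding R_eig R_inv_def unit_eig2
    by (simp add: amult_linear eig2_mult eig2_zero) (simp add: phase_rules chi_psi eig2_minus)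
  moreover have "amult (H \<otimes>\<^sub>a H) R_inv R = unit (H \<otimes>\<^sub>a H)"
    unfolding R_eig R_inv_def unit_eig2
    by (simp add: amult_linear eig2_mult eig2_zero) (simp add: phase_rules chi_psi eig2_minus)
  ultimately show ?thesis by (simp add: is_inverse_def)
qed

lemma comult_fst_R: "comult_fst H R = amult (H \<otimes>\<^sub>a H \<otimes>\<^sub>a H) (place13 H R) (place23 H R)"
  unfolding R_eig
  by (simp add: comult_fst_linear(1) comult_fst_eig2_0 comult_fst_eig2_1[unfolded One_nat_def] place_add place_eig2
     amult_linear eig3_mult eig3_zero)
    (simp add: phase_rules add.commute add.left_commute)

lemma comult_snd_R: "comult_snd H R = amult (H \<otimes>\<^sub>a H \<otimes>\<^sub>a H) (place13 H R) (place12 H R)"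
  unfolding R_eig
  by (simp add: comult_snd_linear(1) comult_snd_eig2_0 comult_snd_eig2_1[unfolded One_nat_def] place_add place_eig2
     amult_linear eig3_mult eig3_zero)
    (simp add: phase_rules add.commute add.left_commute)

lemma comult_bvec:
  assumes "j < N"
  shows "comult H (bvec (j, 0)) = eig2 (\<lambda>l m. \<omega> ^ (j * l) * \<omega> ^ (j * m)) 0 0"
    and "comult H (bvec (j, 1)) = (\<lambda>p. eig2 (\<lambda>l m. \<omega> ^ (j * l) * (\<omega> ^ (j * m) * (- 1) ^ m)) 1 0 p +
      eig2 (\<lambda>l m. \<omega> ^ (j * l) * \<omega> ^ (j * m)) 0 1 p)"
  using assms N_pos
  unfolding One_nat_def by (simp_all add: radford_comult bvec_tensor_eig root_power_shift)

lemma flip_eig2: "(\<lambda>(x, y). eig2 c a b (y, x)) = eig2 (\<lambda>l m. c m l) b a"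
proof -
  have "eig2 c a b (y, x) = eig2 (\<lambda>l m. c m l) b a (x, y)" for x y
    unfolding eig2_apply by (subst sum.swap) (simp add: mult_ac)
  then show ?thesis by (simp add: fun_eq_iff)
qed

lemma root_power_rules:
  "\<omega> ^ (j * (l mod N)) = \<omega> ^ (j * l)" "\<omega> ^ (j * (l + \<nu>)) = \<omega> ^ (j * l) * (- 1) ^ j"
  unfolding mult.commute[of j]
  by (simp_all only: power_mult root_power_mod power_add root_half power_mult_distrib)

text \<open>
  Both sides are linear in \<open>h\<close>, so \<open>h = g\<^sup>j\<close> and \<open>h = g\<^sup>j x\<close> suffice. In the second case the part of \<open>R\<close>
  with \<open>\<beta>\<close> contributes nothing, since it has an \<open>x\<close> in both slots, and the two summands of the
  coproduct are matched crosswise by the signs from shifting \<open>\<chi>\<close>.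
\<close>

lemma R_intertwines:
  assumes "h \<in> elems H"
  shows "amult (H \<otimes>\<^sub>a H) (\<lambda>(a, b). comult H h (b, a)) R = amult (H \<otimes>\<^sub>a H) R (comult H h)"
proof (rule linear_ext_elems[OF assms])
  show "finite (basis H)" by (simp add: radford_hopf_sel)
  have flip_add: "(\<lambda>(a, b). u (b, a) + v (b, a)) = (\<lambda>p. (\<lambda>(a, b). u (b, a)) p + (\<lambda>(a, b). v (b, a)) p)"
    "(\<lambda>(a, b). c * u (b, a)) = (\<lambda>p. c * (\<lambda>(a, b). u (b, a)) p)"
    for u v :: "(nat \<times> nat) \<times> (nat \<times> nat) \<Rightarrow> 'k" and c
    by auto
  show "amult (H \<otimes>\<^sub>a H) (\<lambda>(a, b). comult H (\<lambda>x. u x + v x) (b, a)) R =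
      (\<lambda>p. amult (H \<otimes>\<^sub>a H) (\<lambda>(a, b). comult H u (b, a)) R p +
        amult (H \<otimes>\<^sub>a H) (\<lambda>(a, b). comult H v (b, a)) R p)" for u v
    by (simp only: comult_linear flip_add amult_linear)
  show "amult (H \<otimes>\<^sub>a H) (\<lambda>(a, b). comult H (\<lambda>x. c * u x) (b, a)) R =
      (\<lambda>p. c * amult (H \<otimes>\<^sub>a H) (\<lambda>(a, b). comult H u (b, a)) R p)" for c u
    by (simp only: comult_linear flip_add amult_linear)
  show "amult (H \<otimes>\<^sub>a H) R (comult H (\<lambda>x. u x + v x)) =
      (\<lambda>p. amult (H \<otimes>\<^sub>a H) R (comult H u) p + amult (H \<otimes>\<^sub>a H) R (comult H v) p)" for u v
    by (simp only: comult_linear amult_linear)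
  show "amult (H \<otimes>\<^sub>a H) R (comult H (\<lambda>x. c * u x)) = (\<lambda>p. c * amult (H \<otimes>\<^sub>a H) R (comult H u) p)" for c u
    by (simp only: comult_linear amult_linear)
  fix b assume "b \<in> basis H"
  then obtain j where j: "j < N" and "b = (j, 0) \<or> b = (j, 1)"
    by (cases b) (auto simp: radford_hopf_sel less_2_cases_iff)
  then show "amult (H \<otimes>\<^sub>a H) (\<lambda>(x, y). comult H (bvec b) (y, x)) R = amult (H \<otimes>\<^sub>a H) R (comult H (bvec b))"
  proof (elim disjE)
    assume b: "b = (j, 0)"
    show ?thesis
      unfolding b comult_bvec(1)[OF j] flip_eig2 R_eig
      by (simp add: amult_linear eig2_mult eig2_zero)
        (simp add: phase_rules root_power_rules)
  next
    assume b: "b = (j, 1)"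
    show ?thesis
      unfolding b comult_bvec(2)[OF j] flip_add flip_eig2 R_eig
      by (simp add: amult_linear eig2_mult eig2_zero)
        (simp add: phase_rules root_power_rules add_ac)
  qed
qed

lemma quasitriangular_R: "quasitriangular H R"
  unfolding quasitriangular_def
  using radford_hopf_algebra[OF odd_nu] R_is_inverse comult_fst_R comult_snd_R R_intertwines by blast

text \<open>
  The mixed form of the Yang-Baxter equation. Only exponents of \<open>x\<close> at most \<open>1\<close> survive, which leaves the
  terms of degree at most one in \<open>\<beta>\<close>. Take for instance the term with \<open>x\<close> in the slots \<open>1\<close> and \<open>2\<close>: on
  the left it meets \<open>\<psi>(n, l + \<nu>) \<chi>(m + \<nu>, n)\<close>, on the right \<open>\<psi>(n, l) \<chi>(m, n)\<close>, and these agree because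
  both shifts produce \<open>(-1)\<^sup>n\<close>.
\<close>

lemma yang_baxter_R:
  "amult (H \<otimes>\<^sub>a H \<otimes>\<^sub>a H) (amult (H \<otimes>\<^sub>a H \<otimes>\<^sub>a H) (place12 H R) (place31 H R_inv)) (place23 H R) =
   amult (H \<otimes>\<^sub>a H \<otimes>\<^sub>a H) (amult (H \<otimes>\<^sub>a H \<otimes>\<^sub>a H) (place23 H R) (place31 H R_inv)) (place12 H R)"
  unfolding R_eig R_inv_def
  by (simp add: place_add place_eig2
     amult_linear eig3_mult eig3_zero)
    (simp add: phase_rules add.commute add.left_commute)

lemma pseudotriangular_R: "pseudotriangular H R"
proof -
  have "(THE R'. is_inverse (H \<otimes>\<^sub>a H) R R') = R_inv"
    using R_is_inverse inverse_unique[OF assoc_algebra_tensor[OF assoc_algebra_H assoc_algebra_H]]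
    by (intro the_equality) blast+
  then show ?thesis
    by (simp add: pseudotriangular_def Let_def quasitriangular_R yang_baxter_R)
qed

end

theorem theorem3p1:
  fixes \<nu> s :: nat and \<omega> \<beta> :: "'k::field"
  assumes "odd \<nu>"
    and "primitive_root_of_unity (2 * \<nu>) \<omega>"
    and "of_nat (2 * \<nu>) \<noteq> (0 :: 'k)"
    and "odd s" and "1 \<le> s" and "s < 2 * \<nu>"
  shows "pseudotriangular (radford_hopf \<nu>) (radford_R \<nu> \<omega> s \<beta>)"
proof -
  interpret radford_matrix \<nu> \<omega> s \<beta>
    using assms by unfold_locales
  show ?thesis by (rule pseudotriangular_R)
qed

end
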